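(* Let $\lambda>0$, $c>0$, $t>0$ and let $k\ge 1$ be an integer. Let $\eta_k(t)$ be the hyperbolic distance from the origin $O$, at time $t$, of the particle that returns to the origin for the last time at the $k$-th Poisson event, as described in the context. Then $$E\{\cosh\eta_k(t)\mid N(t)\ge k\}=\frac{\lambda^k e^{-\lambda t}}{\Pr\{N(t)\ge k\}}\int_0^t\mathrm dt_1\int_{t_1}^{t}\mathrm dt_2\cdots\int_{t_{k-1}}^t e^{\lambda(t-t_k)}E(t-t_k)\,\mathrm dt_k$$ $$=\frac{\lambda^k e^{-\lambda t}}{\Pr\{N(t)\ge k\}\,(k-1)!}\int_0^t e^{\lambda(t-t_k)}\,t_k^{k-1}\,E(t-t_k)\,\mathrm dt_k,$$ where $t_0=0$ and, for $s\ge 0$, $$E(s)=e^{-\frac{\lambda s}{2}}\left\{\cosh\frac{s\sqrt{\lambda^2+4c^2}}{2}+\frac{\lambda}{\sqrt{\lambda^2+4c^2}}\sinh\frac{s\sqrt{\lambda^2+4c^2}}{2}\right\}.$$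
   Context: Basic motion: on the Poincaré upper half-plane $H_2^+=\{(x,y):y>0\}$ with metric $\mathrm ds^2=(\mathrm dx^2+\mathrm dy^2)/y^2$, a particle starts at the origin $O=(0,1)$ and moves with constant hyperbolic speed $c>0$ along geodesics, initially on the half-circumference with center $(0,0)$ and radius $1$. Changes of direction occur at the event times $0<T_1<T_2<\cdots$ of a homogeneous Poisson process $N(t)$ of rate $\lambda>0$: at time $T_n$ the particle is at a point $P_n$ and starts moving along the geodesic through $P_n$ orthogonal to the geodesic joining $O$ and $P_n$, in either of the two directions with probability $1/2$ each. By the hyperbolic Pythagorean theorem, the distance $\eta(t)\ge 0$ from $O$ satisfies, on $\{N(t)=n\}$ and with $T_0=0$, $\cosh\eta(t)=\cosh c(t-T_n)\prod_{j=1}^{n}\cosh c(T_j-T_{j-1})$. Motion with return to the origin at the $k$-th event: at the time $T_k=\inf\{t:N(t)=k\}$ the particle jumps back to $O$ and commences the motion from scratch (for the last time), the subsequent changes of direction being governed by the same Poisson process, i.e. occurring at $T_{k+1},T_{k+2},\dots$. Its hyperbolic distance from $O$ at time $t\ge T_k$ is denoted $\eta_k(t)=\eta(t-T_k)$; on $\{N(t)=n\}$ with $n\ge k$ it is given by $$\cosh\eta_k(t)=\cosh c(t-T_n)\prod_{j=k+1}^{n}\cosh c(T_j-T_{j-1}),$$ the empty product being $1$. *)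

theory Defs
  imports "HOL-Probability.Probability"
begin

section \<open>The Poincare upper half-plane\<close>

text \<open>
  The half-plane is the set of complex numbers with positive imaginary part, and the origin
  \<open>O = (0,1)\<close> is \<open>\<i>\<close>.  The metric is \<open>(dx\<^sup>2 + dy\<^sup>2) / y\<^sup>2\<close>, so a tangent vector \<open>v\<close> at \<open>z\<close> has
  hyperbolic length \<open>norm v / Im z\<close>, and hyperbolic angles are Euclidean angles.
\<close>

definition hyp_length :: "(real \<Rightarrow> complex) \<Rightarrow> real" where
  "hyp_length p = integral {0..1} (\<lambda>s. norm (vector_derivative p (at s)) / Im (p s))"

text \<open>
  Only curves that are continuously differentiable on all of \<open>{0..1}\<close> are admitted:
  for the library's piecewise notion the derivative may blow up at the exceptional points, and
  the integral of a non-integrable speed would be \<open>0\<close>.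
\<close>

definition hyp_dist :: "complex \<Rightarrow> complex \<Rightarrow> real" where
  "hyp_dist z w = Inf {hyp_length p | p.
     p C1_differentiable_on {0..1} \<and> (\<forall>s\<in>{0..1}. 0 < Im (p s)) \<and> p 0 = z \<and> p 1 = w}"

definition geodesic_lines :: "complex set set" where
  "geodesic_lines =
     {{z. 0 < Im z \<and> Re z = a} | a. True} \<union>
     {{z. 0 < Im z \<and> dist z (of_real a) = r} | a r. 0 < r}"

definition unit_speed_geodesic :: "(real \<Rightarrow> complex) \<Rightarrow> bool" where
  "unit_speed_geodesic g \<longleftrightarrow>
     (\<exists>L\<in>geodesic_lines. range g \<subseteq> L) \<and>
     g C1_differentiable_on UNIV \<and>
     (\<forall>s. norm (vector_derivative g (at s)) / Im (g s) = 1)"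

section \<open>The motion\<close>

text \<open>
  The motion from scratch starts at \<open>O\<close> on the half-circumference with center \<open>(0,0)\<close> and
  radius 1; which of its two directions is taken is left open.
\<close>

definition starts_at_origin :: "(real \<Rightarrow> complex) \<Rightarrow> bool" where
  "starts_at_origin g \<longleftrightarrow> g 0 = \<i> \<and> range g \<subseteq> {z. norm z = 1}"

text \<open>
  Here \<open>g\<close> leaves \<open>P\<close> orthogonally to the geodesic \<open>h\<close> joining \<open>O\<close> and \<open>P\<close>; \<open>e = 1\<close>
  and \<open>e = -1\<close> are the two possible directions.  As both geodesics have unit speed, both
  tangent vectors at \<open>P\<close> have Euclidean norm \<open>Im P\<close>.
\<close>

definition turns_at :: "real \<Rightarrow> complex \<Rightarrow> (real \<Rightarrow> complex) \<Rightarrow> bool" where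
  "turns_at e P g \<longleftrightarrow> g 0 = P \<and>
     (\<exists>h d. unit_speed_geodesic h \<and> 0 < d \<and> h 0 = \<i> \<and> h d = P \<and>
        vector_derivative g (at 0) = of_real e * \<i> * vector_derivative h (at d))"

text \<open>
  A path \<open>x\<close> with speed \<open>c\<close>, event times \<open>T 1 < T 2 < \<dots>\<close> (and \<open>T 0 = 0\<close>) and directions \<open>e\<close>:
  between the \<open>n\<close>-th and the next event the particle follows \<open>g n\<close>.  At the events
  with index in \<open>R\<close> it jumps to \<open>O\<close> and starts from scratch; at every other event it turns at
  the point it has reached.  The basic motion is the case \<open>R = {}\<close>; the last return happens at
  the \<open>k\<close>-th event if \<open>k \<in> R\<close> and \<open>R \<subseteq> {1..k}\<close>, a single return being \<open>R = {k}\<close>.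
\<close>

definition motion ::
  "real \<Rightarrow> nat set \<Rightarrow> (nat \<Rightarrow> real) \<Rightarrow> (nat \<Rightarrow> real) \<Rightarrow> (real \<Rightarrow> complex) \<Rightarrow> bool" where
  "motion c R T e x \<longleftrightarrow> (\<exists>g.
     (\<forall>n. unit_speed_geodesic (g n) \<and>
          (\<forall>s\<in>{T n..<T (Suc n)}. x s = g n (c * (s - T n)))) \<and>
     starts_at_origin (g 0) \<and>
     (\<forall>n. if Suc n \<in> R then starts_at_origin (g (Suc n))
          else turns_at (e (Suc n)) (g n (c * (T (Suc n) - T n))) (g (Suc n))))"

text \<open>
  Event times of a homogeneous Poisson process of rate \<open>lam\<close>, i.e. i.i.d. exponential waiting
  times, together with fair directions \<open>e n\<close>, all independent.
\<close>

locale poisson_turning = prob_space M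
  for M :: "'a measure" +
  fixes lam :: real
    and T :: "nat \<Rightarrow> 'a \<Rightarrow> real"
    and e :: "nat \<Rightarrow> 'a \<Rightarrow> real"
  assumes T_0: "\<And>\<omega>. \<omega> \<in> space M \<Longrightarrow> T 0 \<omega> = 0"
    and waiting_time: "\<And>n. distributed M lborel (\<lambda>\<omega>. T (Suc n) \<omega> - T n \<omega>) (exponential_density lam)"
    and fair: "\<And>n. prob {\<omega>\<in>space M. e n \<omega> = 1} = 1 / 2"
      "\<And>n. prob {\<omega>\<in>space M. e n \<omega> = -1} = 1 / 2"
    and indep: "indep_vars (\<lambda>_. borel) (case_sum (\<lambda>n \<omega>. T (Suc n) \<omega> - T n \<omega>) e) UNIV"

definition event_count :: "(nat \<Rightarrow> 'a \<Rightarrow> real) \<Rightarrow> real \<Rightarrow> 'a \<Rightarrow> nat" where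
  "event_count T t \<omega> = card {n. 1 \<le> n \<and> T n \<omega> \<le> t}"

section \<open>The right-hand sides\<close>

definition mean_cosh :: "real \<Rightarrow> real \<Rightarrow> real \<Rightarrow> real" where
  "mean_cosh lam c s =
     exp (- (lam * s / 2)) *
     (cosh (s * sqrt (lam\<^sup>2 + 4 * c\<^sup>2) / 2) +
      lam / sqrt (lam\<^sup>2 + 4 * c\<^sup>2) * sinh (s * sqrt (lam\<^sup>2 + 4 * c\<^sup>2) / 2))"

text \<open>
  \<open>iterated_integral k f t a\<close> is the \<open>k\<close>-fold integral of \<open>f t\<^sub>k\<close>, where \<open>t\<^sub>1\<close> ranges over
  \<open>{a..t}\<close> and each \<open>t\<^sub>j\<^sub>+\<^sub>1\<close> over \<open>{t\<^sub>j..t}\<close>.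
\<close>

primrec iterated_integral :: "nat \<Rightarrow> (real \<Rightarrow> real) \<Rightarrow> real \<Rightarrow> real \<Rightarrow> real" where
  "iterated_integral 0 f t a = f a"
| "iterated_integral (Suc k) f t a = integral {a..t} (\<lambda>s. iterated_integral k f t s)"

end

theory Submission
  imports Defs
begin

text \<open>
  Put \<open>G z = cosh d(\<i>, z) = (\<bar>z\<bar>\<^sup>2 + 1) / (2 Im z)\<close>. Along a unit speed geodesic \<open>G\<close> is a combination of
  \<open>exp s\<close> and \<open>exp (- s)\<close>, and its derivative vanishes at \<open>\<i>\<close> and in directions orthogonal to the
  geodesic from \<open>\<i>\<close>. Hence every leg of length \<open>s\<close> after the last return multiplies \<open>G\<close> by \<open>cosh s\<close>.

  Write \<open>K f s = \<integral> lam * exp (- lam * w) * f (s - w) dw\<close> and \<open>K\<^sub>c\<close> for the same operator with the additional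
  factor \<open>cosh (c * w)\<close>, the integrals being over \<open>0 \<le> w \<le> s\<close>. Integrating out the exponential
  waiting times one after the other, starting with the last, the contribution of \<open>N(t) = k + m\<close> to
  the mean is \<open>K\<^sup>k K\<^sub>c\<^sup>m f\<close> at \<open>t\<close>, where \<open>f s = exp (- lam * s) * cosh (c * s)\<close>. The closed form \<open>E\<close> solves
  \<open>E = f + K\<^sub>c E\<close>, and \<open>K\<^sub>c\<^sup>m E \<rightarrow> 0\<close>, so the sum over \<open>m\<close> is \<open>K\<^sup>k E\<close> at \<open>t\<close>; this is the iterated
  integral. Everything is nonnegative, so no integrability has to be checked on the way.
\<close>

section \<open>The distance from the origin\<close>

definition cosh_from_origin :: "complex \<Rightarrow> real" where
  "cosh_from_origin z = ((Re z)\<^sup>2 + (Im z)\<^sup>2 + 1) / (2 * Im z)"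

text \<open>The rotation z -> (a z - b) / (b z + a) about \<open>\<i>\<close> has to carry
  \<open>w\<close> to the point \<open>\<i> * v\<close>: the two equations are the real and
  imaginary parts of a w - b = \<open>\<i>\<close> v (b w + a). The angle is determined by requiring
  that (a w - b) times the conjugate of b w + a has real part 0.\<close>

lemma rotation_to_imaginary_axis:
  assumes "0 < Im w"
  obtains a b v :: real where "a\<^sup>2 + b\<^sup>2 = 1" "0 < v"
    "a * Re w - b = - v * b * Im w" "a * Im w = v * (b * Re w + a)"
    "v = Im w / ((b * Re w + a)\<^sup>2 + (b * Im w)\<^sup>2)"
proof -
  \<comment> \<open>In the double angle \<open>p\<close> this requirement reads
    \<open>sin p * q + cos p * Re w = 0\<close>, which the argument of the number with real part
    \<open>- q\<close> and imaginary part \<open>Re w\<close> solves. For \<open>w = \<i>\<close>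
    that number is 0 and every angle is a solution.\<close>
  define q where "q = ((Re w)\<^sup>2 + (Im w)\<^sup>2 - 1) / 2"
  define p where "p = Arg (Complex (- q) (Re w))"
  define a b where "a = cos (p / 2)" and "b = sin (p / 2)"
  define N where "N = (b * Re w + a)\<^sup>2 + (b * Im w)\<^sup>2"
  define v where "v = Im w / N"
  have ab: "a\<^sup>2 + b\<^sup>2 = 1"
    by (simp add: a_def b_def)
  have "Complex (- q) (Re w) = rcis (cmod (Complex (- q) (Re w))) p"
    by (simp add: p_def rcis_cmod_Arg)
  then obtain r where r: "- q = r * cos p" "Re w = r * sin p"
    by (metis complex.sel Re_rcis Im_rcis)
  have "sin p = 2 * b * a" "cos p = a\<^sup>2 - b\<^sup>2"
    using sin_double[of "p / 2"] cos_double[of "p / 2"] by (simp_all add: a_def b_def)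
  moreover have "sin p * q + cos p * Re w = 0"
    using r by algebra
  ultimately have "2 * b * a * q + (a\<^sup>2 - b\<^sup>2) * Re w = 0"
    by simp
  then have orth: "a * b * ((Re w)\<^sup>2 + (Im w)\<^sup>2) + a\<^sup>2 * Re w - b\<^sup>2 * Re w - a * b = 0"
    by (simp add: q_def field_simps)
  have "N \<noteq> 0"
  proof
    assume "N = 0"
    then have "b * Im w = 0" "b * Re w + a = 0"
      by (auto simp: N_def sum_power2_eq_zero_iff)
    with assms ab show False by auto
  qed
  moreover have "0 \<le> N" by (simp add: N_def)
  ultimately have N: "0 < N" by simp
  have 1: "(a * Re w - b) * N = - Im w * b * Im w"
    using orth ab unfolding N_def by algebra
  have 2: "a * Im w * N = Im w * (b * Re w + a)"
    using orth ab unfolding N_def by algebra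
  show ?thesis
  proof (rule that[of a b v])
    show "a * Re w - b = - v * b * Im w" "a * Im w = v * (b * Re w + a)"
      using 1 2 N by (simp_all add: v_def field_simps)
    show "v = Im w / ((b * Re w + a)\<^sup>2 + (b * Im w)\<^sup>2)"
      by (simp add: v_def N_def)
  qed (use ab N assms in \<open>auto simp: v_def\<close>)
qed

lemma DERIV_ln_comp:
  fixes f :: "real \<Rightarrow> real"
  assumes "(f has_real_derivative D) (at x within S)" "0 < f x"
  shows "((\<lambda>x. ln (f x)) has_real_derivative D / f x) (at x within S)"
  using assms by (auto intro!: derivative_eq_intros)

text \<open>
  The function \<open>h\<close> is the logarithm of the height of the image of \<open>z\<close> under the rotation
  \<open>z \<mapsto> (a z - b) / (b z + a)\<close> about \<open>\<i>\<close>; its hyperbolic gradient has norm 1.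
\<close>

lemma ln_height_le_hyp_length:
  fixes a b :: real
  defines "h \<equiv> \<lambda>z. ln (Im z) - ln ((b * Re z + a)\<^sup>2 + (b * Im z)\<^sup>2)"
  assumes ab: "a\<^sup>2 + b\<^sup>2 = 1"
    and C1: "p C1_differentiable_on {0..1}" and pos: "\<And>s. s \<in> {0..1} \<Longrightarrow> 0 < Im (p s)"
  shows "\<bar>h (p 1) - h (p 0)\<bar> \<le> hyp_length p"
proof -
  from C1 obtain D where D: "\<And>s. s \<in> {0..1} \<Longrightarrow> (p has_vector_derivative D s) (at s)"
    and contD: "continuous_on {0..1} D"
    unfolding C1_differentiable_on_def by blast
  define A B N where "A = (\<lambda>s. b * Re (p s) + a)" and "B = (\<lambda>s. b * Im (p s))"
    and "N = (\<lambda>s. (A s)\<^sup>2 + (B s)\<^sup>2)"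
  define h' where "h' = (\<lambda>s. Im (D s) / Im (p s) -
    (2 * A s * (b * Re (D s)) + 2 * B s * (b * Im (D s))) / N s)"
  have Npos: "0 < N s" if "s \<in> {0..1}" for s
  proof -
    have "A s \<noteq> 0 \<or> B s \<noteq> 0"
      using pos[OF that] ab by (auto simp: A_def B_def)
    then show ?thesis
      by (auto simp: N_def sum_power2_gt_zero_iff)
  qed
  have deriv: "((\<lambda>s. h (p s)) has_vector_derivative h' s) (at s within {0..1})" if s: "s \<in> {0..1}" for s
  proof -
    have R: "((\<lambda>s. Re (p s)) has_real_derivative Re (D s)) (at s within {0..1})"
      and I: "((\<lambda>s. Im (p s)) has_real_derivative Im (D s)) (at s within {0..1})"
      using D[OF s, THEN has_vector_derivative_at_within]
      by (auto intro: bounded_linear.has_vector_derivative[OF bounded_linear_Re]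
          bounded_linear.has_vector_derivative[OF bounded_linear_Im]
          simp: has_real_derivative_iff_has_vector_derivative)
    have "(A has_real_derivative b * Re (D s)) (at s within {0..1})"
      "(B has_real_derivative b * Im (D s)) (at s within {0..1})"
      unfolding A_def B_def using DERIV_cmult[OF R] DERIV_cmult[OF I] DERIV_add[OF _ DERIV_const]
      by fastforce+
    then have "(N has_real_derivative 2 * A s * (b * Re (D s)) + 2 * B s * (b * Im (D s)))
        (at s within {0..1})"
      unfolding N_def by (auto intro!: derivative_eq_intros)
    from DERIV_diff[OF DERIV_ln_comp[OF I pos[OF s]] DERIV_ln_comp[OF this Npos[OF s]]]
    show ?thesis
      unfolding h_def has_real_derivative_iff_has_vector_derivative[symmetric] h'_def
      by (simp add: N_def A_def B_def)
  qed
  have le: "norm (h' s) \<le> norm (vector_derivative p (at s)) / Im (p s)" if s: "s \<in> {0..1}" for s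
  proof -
    \<comment> \<open>\<open>x\<close> is the imaginary part of \<open>D s\<close> times the
      conjugate of the square of \<open>A s + \<i> * B s\<close>, a number of modulus
      \<open>N s\<close>. The square that appears below is that of the real part.\<close>
    define x where "x = Im (D s) * ((A s)\<^sup>2 - (B s)\<^sup>2) - Re (D s) * (2 * A s * B s)"
    have eq: "h' s = x / (N s * Im (p s))"
      using pos[OF s] Npos[OF s] unfolding h'_def x_def
      by (simp add: field_simps) (simp add: N_def B_def power2_eq_square algebra_simps)
    have "x\<^sup>2 \<le> ((Re (D s))\<^sup>2 + (Im (D s))\<^sup>2) * (N s)\<^sup>2"
    proof -
      have "((Re (D s))\<^sup>2 + (Im (D s))\<^sup>2) * (N s)\<^sup>2 - x\<^sup>2 =
        (Re (D s) * ((A s)\<^sup>2 - (B s)\<^sup>2) + Im (D s) * (2 * A s * B s))\<^sup>2"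
        unfolding x_def N_def by algebra
      then show ?thesis by (metis zero_le_power2 diff_ge_0_iff_ge)
    qed
    then have "\<bar>x\<bar> \<le> norm (D s) * N s"
      using Npos[OF s]
      by - (rule power2_le_imp_le, simp_all add: power_mult_distrib cmod_power2)
    then show ?thesis
      using pos[OF s] Npos[OF s] D[OF s]
      by (simp add: eq vector_derivative_at divide_simps abs_mult mult_ac)
  qed
  have contp: "continuous_on {0..1} p"
    using D has_vector_derivative_continuous by (blast intro: continuous_at_imp_continuous_on)
  have "(\<lambda>s. norm (D s) / Im (p s)) integrable_on {0..1}"
    using pos by (intro integrable_continuous_real continuous_intros contD contp) force
  then have int: "(\<lambda>s. norm (vector_derivative p (at s)) / Im (p s)) integrable_on {0..1}"
    by (rule integrable_eq) (metis D vector_derivative_at)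
  have hi: "(h' has_integral h (p 1) - h (p 0)) {0..1}"
    by (rule fundamental_theorem_of_calculus) (use deriv in auto)
  then show ?thesis
    unfolding hyp_length_def
    using integral_norm_bound_integral[OF has_integral_integrable[OF hi] int le]
    by (simp add: integral_unique)
qed

text \<open>After the rotation that sends \<open>w\<close> to \<open>\<i> * v\<close>, the change in
  logarithmic height bounds the length of every admissible curve from below by
  \<open>\<bar>ln v\<bar>\<close>. The vertical segment, rotated back, attains this bound, and
  \<open>cosh (ln v)\<close> is the mean of \<open>v\<close> and its inverse.\<close>

lemma cosh_hyp_dist:
  assumes w: "0 < Im w"
  shows "cosh (hyp_dist \<i> w) = cosh_from_origin w"
proof -
  obtain a b v :: real where ab: "a\<^sup>2 + b\<^sup>2 = 1" and v: "0 < v"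
    and w1: "a * Re w - b = - v * b * Im w" and w2: "a * Im w = v * (b * Re w + a)"
    and v_eq: "v = Im w / ((b * Re w + a)\<^sup>2 + (b * Im w)\<^sup>2)"
    using rotation_to_imaginary_axis[OF w] by metis
  \<comment> \<open>\<open>p\<close> is the inverse rotation z -> (a z + b) / (a - b z) applied to
    \<open>\<i> * Y \<tau>\<close>. The height \<open>Y\<close> runs exponentially from 1 to
    \<open>v\<close>, so the hyperbolic speed is constant.\<close>
  define Y where "Y = (\<lambda>\<tau>. exp (\<tau> * ln v))"
  define den where "den = (\<lambda>\<tau>. complex_of_real a - \<i> * of_real b * of_real (Y \<tau>))"
  define p where "p = (\<lambda>\<tau>. (of_real b + \<i> * of_real a * of_real (Y \<tau>)) / den \<tau>)"
  have Ypos: "0 < Y \<tau>" for \<tau> by (simp add: Y_def)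
  have den0: "den \<tau> \<noteq> 0" for \<tau>
    using ab Ypos[of \<tau>] by (auto simp: den_def complex_eq_iff)
  define D where "D = (\<lambda>\<tau>. \<i> * of_real (ln v * Y \<tau>) / (den \<tau>)\<^sup>2)"
  have ab': "(complex_of_real a)\<^sup>2 + (of_real b)\<^sup>2 = 1"
    using ab by (metis of_real_1 of_real_add of_real_power)
  have dY: "((\<lambda>\<tau>. complex_of_real (Y \<tau>)) has_vector_derivative of_real (ln v * Y \<tau>)) (at \<tau>)" for \<tau>
    unfolding Y_def
    by (intro bounded_linear.has_vector_derivative[OF bounded_linear_of_real],
        unfold has_real_derivative_iff_has_vector_derivative[symmetric])
       (auto intro!: derivative_eq_intros)
  have dp: "(p has_vector_derivative D \<tau>) (at \<tau>)" for \<tau>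
  proof -
    have "((\<lambda>z. (of_real b + \<i> * of_real a * z) / (complex_of_real a - \<i> * of_real b * z))
      has_field_derivative \<i> / (den \<tau>)\<^sup>2) (at (complex_of_real (Y \<tau>)))"
      using den0[of \<tau>] unfolding den_def
      by (auto intro!: derivative_eq_intros simp: power2_eq_square divide_simps)
         (use ab' in algebra)
    from field_vector_diff_chain_at[OF dY this]
    show ?thesis
      by (simp add: o_def p_def den_def D_def mult_ac)
  qed
  have absden: "(cmod (den \<tau>))\<^sup>2 = a\<^sup>2 + b\<^sup>2 * (Y \<tau>)\<^sup>2" for \<tau>
    by (simp add: den_def cmod_power2 power_mult_distrib)
  have Imp: "Im (p \<tau>) = Y \<tau> / (cmod (den \<tau>))\<^sup>2" for \<tau>
  proof -
    have "Im (p \<tau>) = (a * Y \<tau> * a + b * (b * Y \<tau>)) / (cmod (den \<tau>))\<^sup>2"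
      by (simp add: p_def Im_divide cmod_power2 den_def)
    also have "a * Y \<tau> * a + b * (b * Y \<tau>) = Y \<tau>"
      using ab by algebra
    finally show ?thesis .
  qed
  have Impos: "0 < Im (p \<tau>)" for \<tau>
    using Ypos den0 by (simp add: Imp)
  have "continuous_on {0..1} D"
    unfolding D_def den_def Y_def
    by (intro continuous_intros) (use den0 in \<open>auto simp: den_def Y_def\<close>)
  then have pC1: "p C1_differentiable_on {0..1}"
    unfolding C1_differentiable_on_def using dp by blast
  have p0: "p 0 = \<i>"
    using den0[of 0] by (simp add: p_def den_def Y_def divide_simps) (simp add: algebra_simps)
  have "w * den 1 = of_real b + \<i> * of_real a * of_real (Y 1)"
    using w1 w2 v by (simp add: den_def Y_def complex_eq_iff algebra_simps)
  then have p1: "p 1 = w"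
    using den0[of 1] by (simp add: p_def divide_simps)
  have "hyp_length p = integral {0..1} (\<lambda>s::real. \<bar>ln v\<bar>)"
    unfolding hyp_length_def
  proof (rule integral_cong)
    fix \<tau> :: real
    show "norm (vector_derivative p (at \<tau>)) / Im (p \<tau>) = \<bar>ln v\<bar>"
      using Ypos[of \<tau>] den0[of \<tau>]
      by (simp add: vector_derivative_at[OF dp] D_def Imp norm_mult norm_divide norm_power)
  qed
  then have lenp: "hyp_length p = \<bar>ln v\<bar>" by simp
  have "hyp_dist \<i> w = \<bar>ln v\<bar>"
    unfolding hyp_dist_def
  proof (rule cInf_eq_minimum)
    show "\<bar>ln v\<bar> \<in> {hyp_length p | p. p C1_differentiable_on {0..1} \<and>
        (\<forall>s\<in>{0..1}. 0 < Im (p s)) \<and> p 0 = \<i> \<and> p 1 = w}"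
      using lenp pC1 Impos p0 p1 by (intro CollectI exI[of _ p]) auto
  next
    fix l assume "l \<in> {hyp_length p | p. p C1_differentiable_on {0..1} \<and>
        (\<forall>s\<in>{0..1}. 0 < Im (p s)) \<and> p 0 = \<i> \<and> p 1 = w}"
    then obtain q where q: "l = hyp_length q" "q C1_differentiable_on {0..1}"
      "\<forall>s\<in>{0..1}. 0 < Im (q s)" "q 0 = \<i>" "q 1 = w" by blast
    have "0 < (b * Re w + a)\<^sup>2 + (b * Im w)\<^sup>2"
      using v w unfolding v_eq by (simp add: zero_less_divide_iff)
    from ln_divide_pos[OF w this]
    have "ln v = ln (Im w) - ln ((b * Re w + a)\<^sup>2 + (b * Im w)\<^sup>2)"
      unfolding v_eq .
    then show "\<bar>ln v\<bar> \<le> l"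
      using ln_height_le_hyp_length[OF ab q(2)] q ab by (auto simp: add.commute)
  qed
  moreover have "cosh (ln v) = cosh_from_origin w"
  proof -
    define N where "N = (b * Re w + a)\<^sup>2 + (b * Im w)\<^sup>2"
    have N: "v = Im w / N" by (simp add: v_eq N_def)
    then have "N \<noteq> 0" using v by auto
    \<comment> \<open>As |a w - b| = v |b w + a|, this is the identity |a w - b|^2 + |b w + a|^2 =
      |w|^2 + 1 multiplied by \<open>N\<close>.\<close>
    have "(Im w)\<^sup>2 + N\<^sup>2 = N * ((Re w)\<^sup>2 + (Im w)\<^sup>2 + 1)"
    proof -
      have n: "v * N = Im w" using N \<open>N \<noteq> 0\<close> by simp
      have "a * Re w - b = - v * b * Im w" "a * Im w = v * (b * Re w + a)"
        using w1 w2 by auto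
      then have "v\<^sup>2 * N = (a * Re w - b)\<^sup>2 + (a * Im w)\<^sup>2"
        unfolding N_def by algebra
      moreover have "(a * Re w - b)\<^sup>2 + (a * Im w)\<^sup>2 + N = (Re w)\<^sup>2 + (Im w)\<^sup>2 + 1"
        using ab unfolding N_def by algebra
      ultimately show ?thesis using n by algebra
    qed
    then have "(v + inverse v) / 2 = cosh_from_origin w"
      using w \<open>N \<noteq> 0\<close> unfolding cosh_from_origin_def N
      by (simp add: field_simps power2_eq_square)
    then show ?thesis
      using v by (simp add: cosh_ln_real)
  qed
  ultimately show ?thesis
    by (metis cosh_real_abs)
qed

section \<open>The distance along geodesics and along the motion\<close>

definition cosh_from_origin_diff :: "complex \<Rightarrow> complex \<Rightarrow> real" where
  "cosh_from_origin_diff z v =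
     Re z / Im z * Re v + ((Im z)\<^sup>2 - (Re z)\<^sup>2 - 1) / (2 * (Im z)\<^sup>2) * Im v"

lemma DERIV_cosh_from_origin:
  assumes "(g has_vector_derivative v) (at s)" "0 < Im (g s)"
  shows "((\<lambda>s. cosh_from_origin (g s)) has_real_derivative cosh_from_origin_diff (g s) v) (at s)"
proof -
  have *: "((\<lambda>s. (X s ^ 2 + Y s ^ 2 + 1) / (2 * Y s)) has_real_derivative
      X s / Y s * X' + ((Y s)\<^sup>2 - (X s)\<^sup>2 - 1) / (2 * (Y s)\<^sup>2) * Y') (at s)"
    if "(X has_real_derivative X') (at s)" "(Y has_real_derivative Y') (at s)" "0 < Y s"
    for X Y :: "real \<Rightarrow> real" and X' Y'
    using that(3)
    by (auto intro!: derivative_eq_intros that(1,2)) (simp add: field_simps power2_eq_square)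
  show ?thesis
    unfolding cosh_from_origin_def cosh_from_origin_diff_def
    by (rule *) (use assms in \<open>auto simp: has_real_derivative_iff_has_vector_derivative intro:
      bounded_linear.has_vector_derivative[OF bounded_linear_Re]
      bounded_linear.has_vector_derivative[OF bounded_linear_Im]\<close>)
qed

lemma exp_ode_unique:
  fixes f :: "real \<Rightarrow> real"
  assumes "\<And>s. (f has_real_derivative a * f s) (at s)"
  shows "f s = f 0 * exp (a * s)"
proof -
  have "((\<lambda>s. f s * exp (- a * s)) has_real_derivative 0) (at s)" for s
    by (auto intro!: derivative_eq_intros assms)
  from DERIV_isconst_all[OF allI[OF this], of s 0]
  have "f s * exp (- a * s) = f 0" by simp
  then show ?thesis
    by (simp add: exp_minus field_simps)
qed

text \<open>Continuity and connectedness exclude a jump between 1 and -1. It is used to show that a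
  geodesic of unit speed never reverses its direction.\<close>

lemma sign_constant:
  fixes f :: "real \<Rightarrow> real"
  assumes "continuous_on UNIV f" "\<And>s. \<bar>f s\<bar> = 1"
  obtains a where "a = 1 \<or> a = - 1" "\<And>s. f s = a"
proof -
  have "range f \<subseteq> {1, -1}"
  proof
    fix y assume "y \<in> range f"
    then have "\<bar>y\<bar> = 1" using assms(2) by auto
    then show "y \<in> {1, -1}" by (auto simp: abs_if split: if_splits)
  qed
  then have "finite (range f)" by (rule finite_subset) simp
  then have "f constant_on UNIV"
    using assms(1) by (intro continuous_finite_range_constant) auto
  then obtain a where "\<And>s. f s = a" by (auto simp: constant_on_def)
  with assms(2) show ?thesis by (intro that[of a]) (auto simp: abs_if split: if_splits)
qed

section \<open>Unit speed geodesics\<close>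

lemma unit_speed_geodesic_Im_pos:
  assumes "unit_speed_geodesic g"
  shows "0 < Im (g s)"
proof -
  have "\<forall>L\<in>geodesic_lines. L \<subseteq> {z. 0 < Im z}" by (auto simp: geodesic_lines_def)
  then show ?thesis using assms unfolding unit_speed_geodesic_def by blast
qed

lemma unit_speed_geodesic_derivative:
  assumes "unit_speed_geodesic g"
  shows "(g has_vector_derivative vector_derivative g (at s)) (at s)"
    and "continuous_on UNIV (\<lambda>s. vector_derivative g (at s))"
    and "(Re (vector_derivative g (at s)))\<^sup>2 + (Im (vector_derivative g (at s)))\<^sup>2 = (Im (g s))\<^sup>2"
proof -
  from assms obtain D where D: "\<And>s. (g has_vector_derivative D s) (at s)"
    and contD: "continuous_on UNIV D"
    unfolding unit_speed_geodesic_def C1_differentiable_on_def by blast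
  have eq: "vector_derivative g (at s) = D s" for s
    using D by (rule vector_derivative_at)
  show "(g has_vector_derivative vector_derivative g (at s)) (at s)"
    and "continuous_on UNIV (\<lambda>s. vector_derivative g (at s))"
    using D contD by (simp_all add: eq)
  have "norm (vector_derivative g (at s)) = Im (g s)"
    using assms unit_speed_geodesic_Im_pos[OF assms, of s]
    unfolding unit_speed_geodesic_def by (metis divide_eq_1_iff less_irrefl)
  then show "(Re (vector_derivative g (at s)))\<^sup>2 + (Im (vector_derivative g (at s)))\<^sup>2 = (Im (g s))\<^sup>2"
    by (metis cmod_power2)
qed

text \<open>
  On a half-circle of radius \<open>r\<close> with center \<open>(a,0)\<close>, the function \<open>(r + Re z - a) / Im z\<close>
  is the exponential of the signed arc length.
\<close>

lemma cosh_from_origin_geodesic_exp: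
  assumes g: "unit_speed_geodesic g"
  obtains \<alpha> \<beta> :: real where "\<And>s. cosh_from_origin (g s) = \<alpha> * exp s + \<beta> * exp (- s)"
proof -
  define D where "D = (\<lambda>s. vector_derivative g (at s))"
  define x y where "x = (\<lambda>s. Re (g s))" and "y = (\<lambda>s. Im (g s))"
  define x' y' where "x' = (\<lambda>s. Re (D s))" and "y' = (\<lambda>s. Im (D s))"
  have dx: "(x has_real_derivative x' s) (at s)" and dy: "(y has_real_derivative y' s) (at s)" for s
    using unit_speed_geodesic_derivative(1)[OF g, of s]
    by (auto simp: x_def y_def x'_def y'_def D_def has_real_derivative_iff_has_vector_derivative intro:
      bounded_linear.has_vector_derivative[OF bounded_linear_Re]
      bounded_linear.has_vector_derivative[OF bounded_linear_Im])
  have contx': "continuous_on UNIV x'" and conty': "continuous_on UNIV y'"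
    using unit_speed_geodesic_derivative(2)[OF g] unfolding x'_def y'_def D_def
    by (auto intro: continuous_intros)
  have conty: "continuous_on UNIV y"
    using dy by (auto intro!: continuous_at_imp_continuous_on DERIV_isCont)
  have y: "0 < y s" for s
    using unit_speed_geodesic_Im_pos[OF g] by (simp add: y_def)
  have speed: "(x' s)\<^sup>2 + (y' s)\<^sup>2 = (y s)\<^sup>2" for s
    using unit_speed_geodesic_derivative(3)[OF g, of s] by (simp add: x'_def y'_def D_def y_def)
  have G: "cosh_from_origin (g s) = ((x s)\<^sup>2 + (y s)\<^sup>2 + 1) / (2 * y s)" for s
    by (simp add: cosh_from_origin_def x_def y_def)
  note found = that
  \<comment> \<open>\<open>V\<close> stands for the exponential of the arc length, up to a constant
    factor and the orientation: the height on a vertical line, the quotient introduced above on a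
    half-circle. Reversing the orientation swaps the two coefficients.\<close>
  have suffices: thesis if V: "\<And>s. (V has_real_derivative a * V s) (at s)" and a: "a = 1 \<or> a = - 1"
    and V0: "V 0 \<noteq> 0"
    and GV: "\<And>s. cosh_from_origin (g s) = p * V s + q / V s" for V a p q
  proof -
    define w where "w = V 0"
    have "w \<noteq> 0" using V0 by (simp add: w_def)
    have eq: "V s = w * exp (a * s)" for s unfolding w_def using V by (rule exp_ode_unique)
    from a show thesis
    proof
      assume "a = 1"
      with \<open>w \<noteq> 0\<close> show thesis
        by (intro found[of "p * w" "q / w"], subst GV) (simp add: eq exp_minus field_simps)
    next
      assume "a = - 1"
      with \<open>w \<noteq> 0\<close> show thesis
        by (intro found[of "q / w" "p * w"], subst GV) (simp add: eq exp_minus field_simps)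
    qed
  qed
  from g have "\<exists>L\<in>geodesic_lines. range g \<subseteq> L" unfolding unit_speed_geodesic_def by blast
  then consider a where "\<And>s. x s = a" | a r where "0 < r" "\<And>s. dist (g s) (of_real a) = r"
    unfolding geodesic_lines_def x_def by blast
  then show thesis
  proof cases
    case 1
    then have "x = (\<lambda>_. a)" by auto
    with dx have x': "x' s = 0" for s
      using DERIV_unique DERIV_const by metis
    have "\<bar>y' s / y s\<bar> = 1" for s
    proof -
      have "\<bar>y' s\<bar> = y s" using speed[of s] y[of s] x'[of s]
        by (simp add: power2_eq_iff abs_if) (auto)
      then show ?thesis using y[of s] by simp
    qed
    moreover have "continuous_on UNIV (\<lambda>s. y' s / y s)"
      by (intro continuous_intros conty conty') (metis less_irrefl y)
    ultimately obtain b where b: "b = 1 \<or> b = - 1" "\<And>s. y' s / y s = b"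
      using sign_constant[of "\<lambda>s. y' s / y s"] by blast
    have yd: "y' s = b * y s" for s
      using b(2)[of s] y[of s] by (simp add: field_simps)
    show thesis
    proof (rule suffices[of y b "1 / 2" "(a\<^sup>2 + 1) / 2"])
      show "(y has_real_derivative b * y s) (at s)" for s using dy[of s] yd by simp
      show "cosh_from_origin (g s) = 1 / 2 * y s + (a\<^sup>2 + 1) / 2 / y s" for s
        using y[of s] by (simp add: G 1 field_simps power2_eq_square)
    qed (use b(1) y[of 0] in auto)
  next
    case 2
    have circ: "(x s - a)\<^sup>2 + (y s)\<^sup>2 = r\<^sup>2" for s
      using 2(2)[of s] by (auto simp: dist_norm cmod_power2[symmetric] x_def y_def
        cmod_def)
    have tang: "(x s - a) * x' s + y s * y' s = 0" for s
    proof -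
      have "((\<lambda>s. (x s - a)\<^sup>2 + (y s)\<^sup>2) has_real_derivative
          2 * ((x s - a) * x' s + y s * y' s)) (at s)"
        by (auto intro!: derivative_eq_intros dx dy)
      moreover have "((\<lambda>s. (x s - a)\<^sup>2 + (y s)\<^sup>2) has_real_derivative 0) (at s)"
        using circ by simp
      ultimately show ?thesis using DERIV_unique by fastforce
    qed
    \<comment> \<open>The velocity has norm \<open>y s\<close> and is orthogonal to the radius
      \<open>(x s - a, y s)\<close> of length \<open>r\<close>, so its first component is
      \<open>y s * y s / r\<close> up to sign.\<close>
    have "(r * x' s)\<^sup>2 = (y s)\<^sup>2 ^ 2" for s
      using circ[of s] tang[of s] speed[of s] by algebra
    then have "\<bar>r * x' s\<bar> = (y s)\<^sup>2" for s
      by (metis abs_le_square_iff abs_of_nonneg antisym order_refl zero_le_power2 power2_abs)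
    then have "\<bar>r * x' s / (y s)\<^sup>2\<bar> = 1" for s
      using y[of s] by simp
    moreover have "continuous_on UNIV (\<lambda>s. r * x' s / (y s)\<^sup>2)"
      by (intro continuous_intros conty contx') (metis less_irrefl y power_not_zero)
    ultimately obtain b where b: "b = 1 \<or> b = - 1" "\<And>s. r * x' s / (y s)\<^sup>2 = b"
      using sign_constant[of "\<lambda>s. r * x' s / (y s)\<^sup>2"] by blast
    have xd: "r * x' s = b * (y s)\<^sup>2" for s
      using b(2)[of s] y[of s] by (simp add: field_simps)
    define V where "V = (\<lambda>s. (r + (x s - a)) / y s)"
    have inv: "1 / V s = (r - (x s - a)) / y s" for s
    proof -
      have "(r + (x s - a)) * (r - (x s - a)) = y s * y s"
        using circ[of s] by algebra
      moreover from this have "r + (x s - a) \<noteq> 0" using y[of s] by auto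
      ultimately show ?thesis using y[of s] by (simp add: V_def field_simps)
    qed
    have V0: "V s \<noteq> 0" for s
    proof -
      have "(r + (x s - a)) * (r - (x s - a)) = y s * y s"
        using circ[of s] by algebra
      then have "r + (x s - a) \<noteq> 0" using y[of s] by auto
      then show ?thesis using y[of s] by (simp add: V_def)
    qed
    \<comment> \<open>The coefficients come from V + 1/V = 2 r / y, V - 1/V = 2 (x - a) / y and x^2
      + y^2 = a^2 + r^2 + 2 a (x - a).\<close>
    show thesis
    proof (rule suffices[of V b "(a\<^sup>2 + r\<^sup>2 + 1 + 2 * a * r) / (4 * r)" "(a\<^sup>2 + r\<^sup>2 + 1 - 2 * a * r) / (4 * r)"])
      fix s
      have "(x' s * y s - (r + (x s - a)) * y' s) * r = b * (r + (x s - a)) * y s * r"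
      proof -
        \<comment> \<open>The extra factor \<open>y s\<close> is introduced because
          \<open>tang\<close> controls the product \<open>y s * y' s\<close>.\<close>
        have "(x' s * y s - (r + (x s - a)) * y' s) * r * y s = b * (r + (x s - a)) * y s * r * y s"
          using xd[of s] tang[of s] circ[of s] by algebra
        then show ?thesis using y[of s] by simp
      qed
      then have num: "x' s * y s - (r + (x s - a)) * y' s = b * (r + (x s - a)) * y s"
        using 2(1) by simp
      have "(V has_real_derivative (x' s * y s - (r + (x s - a)) * y' s) / (y s * y s)) (at s)"
        unfolding V_def using y[of s] by (auto intro!: derivative_eq_intros dx dy)
      then show "(V has_real_derivative b * V s) (at s)"
        using y[of s] unfolding num by (simp add: V_def)
      have "q / V s = q * ((r - (x s - a)) / y s)" for q
        using inv[of s] by (metis mult.right_neutral times_divide_eq_right)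
      then have "(a\<^sup>2 + r\<^sup>2 + 1 + 2 * a * r) / (4 * r) * V s +
          (a\<^sup>2 + r\<^sup>2 + 1 - 2 * a * r) / (4 * r) / V s =
        (a\<^sup>2 + r\<^sup>2 + 1 + 2 * a * r) / (4 * r) * ((r + (x s - a)) / y s) +
          (a\<^sup>2 + r\<^sup>2 + 1 - 2 * a * r) / (4 * r) * ((r - (x s - a)) / y s)"
        by (simp only: V_def)
      also have "\<dots> = (a\<^sup>2 + r\<^sup>2 + 1 + 2 * a * (x s - a)) / (2 * y s)"
        using y[of s] 2(1) by (simp add: divide_simps) (simp add: algebra_simps)
      also have "a\<^sup>2 + r\<^sup>2 + 1 + 2 * a * (x s - a) = (x s)\<^sup>2 + (y s)\<^sup>2 + 1"
        using circ[of s] by algebra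
      finally show "cosh_from_origin (g s) = (a\<^sup>2 + r\<^sup>2 + 1 + 2 * a * r) / (4 * r) * V s +
          (a\<^sup>2 + r\<^sup>2 + 1 - 2 * a * r) / (4 * r) / V s"
        by (simp add: G)
    qed (use b(1) V0 in auto)
  qed
qed

text \<open>A combination of \<open>exp s\<close> and \<open>exp (- s)\<close> is determined by its
  value and its derivative at 0; these become the coefficients of \<open>cosh\<close> and
  \<open>sinh\<close>.\<close>

lemma cosh_from_origin_geodesic:
  assumes g: "unit_speed_geodesic g"
  shows "cosh_from_origin (g s) = cosh_from_origin (g 0) * cosh s +
    cosh_from_origin_diff (g 0) (vector_derivative g (at 0)) * sinh s"
    and "cosh_from_origin_diff (g s) (vector_derivative g (at s)) = cosh_from_origin (g 0) * sinh s +
    cosh_from_origin_diff (g 0) (vector_derivative g (at 0)) * cosh s"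
proof -
  obtain \<alpha> \<beta> where eq: "\<And>s. cosh_from_origin (g s) = \<alpha> * exp s + \<beta> * exp (- s)"
    using cosh_from_origin_geodesic_exp[OF g] by blast
  have "((\<lambda>s. cosh_from_origin (g s)) has_real_derivative \<alpha> * exp s - \<beta> * exp (- s)) (at s)" for s
    unfolding eq by (auto intro!: derivative_eq_intros)
  then have d: "cosh_from_origin_diff (g s) (vector_derivative g (at s)) = \<alpha> * exp s - \<beta> * exp (- s)" for s
    using DERIV_cosh_from_origin[OF unit_speed_geodesic_derivative(1)[OF g] unit_speed_geodesic_Im_pos[OF g]]
      DERIV_unique by blast
  show "cosh_from_origin (g s) = cosh_from_origin (g 0) * cosh s +
    cosh_from_origin_diff (g 0) (vector_derivative g (at 0)) * sinh s"
    and "cosh_from_origin_diff (g s) (vector_derivative g (at s)) = cosh_from_origin (g 0) * sinh s +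
    cosh_from_origin_diff (g 0) (vector_derivative g (at 0)) * cosh s"
    unfolding eq d by (simp_all add: cosh_def sinh_def field_simps)
qed

lemma cosh_from_origin_start:
  assumes g: "unit_speed_geodesic g" and "g 0 = \<i>"
  shows "cosh_from_origin (g s) = cosh s"
    and "cosh_from_origin_diff (g s) (vector_derivative g (at s)) = sinh s"
  using cosh_from_origin_geodesic[OF g, of s] assms(2)
  by (simp_all add: cosh_from_origin_def cosh_from_origin_diff_def)

text \<open>This is the hyperbolic Pythagorean theorem: the differential of
  \<open>cosh_from_origin\<close> at \<open>P\<close> vanishes in the direction in which
  \<open>g\<close> leaves, so only the \<open>cosh\<close> term of the general formula
  survives.\<close>

lemma cosh_from_origin_turn:
  assumes g: "unit_speed_geodesic g" and turn: "turns_at e P g"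
  shows "cosh_from_origin (g s) = cosh_from_origin P * cosh s"
proof -
  from turn obtain h d where h: "unit_speed_geodesic h" "h 0 = \<i>" "h d = P" and g0: "g 0 = P"
    and g': "vector_derivative g (at 0) = of_real e * \<i> * vector_derivative h (at d)"
    unfolding turns_at_def by blast
  define u v where "u = Re (vector_derivative h (at d))" and "v = Im (vector_derivative h (at d))"
  define x y where "x = Re P" and "y = Im P"
  define p q where "p = x / y" and "q = (y\<^sup>2 - x\<^sup>2 - 1) / (2 * y\<^sup>2)"
  have y: "0 < y"
    using unit_speed_geodesic_Im_pos[OF h(1), of d] h(3) by (simp add: y_def)
  have uv: "u\<^sup>2 + v\<^sup>2 = y\<^sup>2"
    using unit_speed_geodesic_derivative(3)[OF h(1), of d] h(3) by (simp add: u_def v_def y_def)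
  have c: "(x\<^sup>2 + y\<^sup>2 + 1) / (2 * y) = cosh d"
    using cosh_from_origin_start(1)[OF h(1,2), of d] h(3) by (simp add: cosh_from_origin_def x_def y_def)
  have s: "p * u + q * v = sinh d"
    using cosh_from_origin_start(2)[OF h(1,2), of d] h(3)
    by (simp add: cosh_from_origin_diff_def x_def y_def u_def v_def p_def q_def)
  \<comment> \<open>\<open>(p, q)\<close> is the Euclidean gradient at \<open>P\<close>, so the left
    side is the squared hyperbolic norm of the gradient.\<close>
  have "(p\<^sup>2 + q\<^sup>2) * y\<^sup>2 = ((x\<^sup>2 + y\<^sup>2 + 1) / (2 * y))\<^sup>2 - 1"
    using y unfolding p_def q_def
    by (simp add: divide_simps) (simp add: power4_eq_xxxx power2_eq_square algebra_simps)
  also have "\<dots> = (sinh d)\<^sup>2"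
    unfolding c by (simp add: cosh_square_eq)
  \<comment> \<open>Already the derivative along \<open>h\<close> exhausts the norm of the gradient, so it vanishes in the orthogonal direction.\<close>
  finally have "(p * u + q * v)\<^sup>2 + (q * u - p * v)\<^sup>2 = (sinh d)\<^sup>2"
    using uv by algebra
  then have "q * u - p * v = 0"
    unfolding s by simp
  then have "cosh_from_origin_diff P (of_real e * \<i> * vector_derivative h (at d)) = 0"
    by (simp add: cosh_from_origin_diff_def flip: x_def y_def u_def v_def p_def q_def)
  then show ?thesis
    using cosh_from_origin_geodesic(1)[OF g, of s] g0 g' by simp
qed

text \<open>Leg \<open>k\<close> starts afresh at \<open>\<i>\<close>, and no later index lies in
  \<open>R\<close>. Every event after the \<open>k\<close>-th is therefore a right-angled turn,
  which multiplies by the \<open>cosh\<close> of the completed leg.\<close>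

lemma cosh_hyp_dist_motion:
  assumes mot: "motion c R T e x" and k: "k \<in> R" "R \<subseteq> {1..k}"
    and n: "k \<le> n" and s: "T n \<le> s" "s < T (Suc n)"
  shows "cosh (hyp_dist \<i> (x s)) =
    cosh (c * (s - T n)) * (\<Prod>j=k..<n. cosh (c * (T (Suc j) - T j)))"
proof -
  from mot obtain g where g: "\<And>n. unit_speed_geodesic (g n)"
    and xg: "\<And>n s. s \<in> {T n..<T (Suc n)} \<Longrightarrow> x s = g n (c * (s - T n))"
    and next_leg: "\<And>n. if Suc n \<in> R then starts_at_origin (g (Suc n))
          else turns_at (e (Suc n)) (g n (c * (T (Suc n) - T n))) (g (Suc n))"
    unfolding motion_def by blast
  have leg: "cosh_from_origin (g n u) = cosh u * (\<Prod>j=k..<n. cosh (c * (T (Suc j) - T j)))" for u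
    using n
  proof (induction n arbitrary: u rule: dec_induct)
    case base
    \<comment> \<open>\<open>g k\<close> begins at the \<open>k\<close>-th event, which the clause
      for \<open>Suc n\<close> describes at \<open>n = k - 1\<close>;
      \<open>R \<subseteq> {1..k}\<close> excludes \<open>k = 0\<close>.\<close>
    have "k = Suc (k - 1)" using k by auto
    then have "starts_at_origin (g k)" using next_leg[of "k - 1"] k(1) by simp
    then show ?case
      using cosh_from_origin_start(1)[OF g] by (simp add: starts_at_origin_def)
  next
    case (step n)
    have "Suc n \<notin> R" using k(2) step by auto
    then have "turns_at (e (Suc n)) (g n (c * (T (Suc n) - T n))) (g (Suc n))"
      using next_leg[of n] by simp
    from cosh_from_origin_turn[OF g this] show ?case
      using step by simp
  qed
  have "x s = g n (c * (s - T n))" using xg s by simp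
  then show ?thesis
    using cosh_hyp_dist[OF unit_speed_geodesic_Im_pos[OF g]] leg by simp
qed

section \<open>Convolution on the half-line and the renewal equation\<close>

text \<open>\<open>q\<close> weighs the waiting time \<open>w\<close>, and \<open>s - w\<close> is
  the time left after it. The truncation makes the value 0 for negative \<open>s\<close>, when the
  time is already used up.\<close>

definition half_line_conv :: "(real \<Rightarrow> real) \<Rightarrow> (real \<Rightarrow> ennreal) \<Rightarrow> real \<Rightarrow> ennreal" where
  "half_line_conv q f s = (\<integral>\<^sup>+w. ennreal (q w) * f (s - w) * indicator {0..s} w \<partial>lborel)"

lemma half_line_conv_measurable [measurable]:
  assumes [measurable]: "q \<in> borel_measurable borel" "f \<in> borel_measurable borel"
  shows "half_line_conv q f \<in> borel_measurable borel"
proof -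
  \<comment> \<open>The interval depends on \<open>s\<close>; as a product of indicators of fixed
    sets the integrand is visibly measurable in both variables jointly.\<close>
  have "half_line_conv q f =
    (\<lambda>s. \<integral>\<^sup>+w. ennreal (q w) * f (s - w) * (indicator {0..} w * indicator {0..} (s - w)) \<partial>lborel)"
    unfolding half_line_conv_def by (intro ext nn_integral_cong) (auto split: split_indicator)
  then show ?thesis by simp
qed

lemma half_line_conv_power_measurable [measurable]:
  assumes [measurable]: "q \<in> borel_measurable borel" "f \<in> borel_measurable borel"
  shows "(half_line_conv q ^^ n) f \<in> borel_measurable borel"
  by (induction n) auto

lemma half_line_conv_cong:
  assumes "\<And>u. 0 \<le> u \<Longrightarrow> u \<le> s \<Longrightarrow> f u = g u"
  shows "half_line_conv q f s = half_line_conv q g s"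
  unfolding half_line_conv_def using assms
  by (intro nn_integral_cong) (auto split: split_indicator)

text \<open>The convolution at \<open>s\<close> looks at its argument on \<open>{0..s}\<close> only.
  Hence identities valid just for nonnegative times may be used under the iterates.\<close>

lemma half_line_conv_power_cong:
  assumes "\<And>u. 0 \<le> u \<Longrightarrow> u \<le> t \<Longrightarrow> f u = g u" "0 \<le> s" "s \<le> t"
  shows "(half_line_conv q ^^ n) f s = (half_line_conv q ^^ n) g s"
  using assms(2,3)
  by (induction n arbitrary: s) (auto simp: assms(1) intro!: half_line_conv_cong)

lemma half_line_conv_add:
  assumes [measurable]: "q \<in> borel_measurable borel" "f \<in> borel_measurable borel" "g \<in> borel_measurable borel"
  shows "half_line_conv q (\<lambda>s. f s + g s) s = half_line_conv q f s + half_line_conv q g s"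
  unfolding half_line_conv_def by (subst nn_integral_add[symmetric]) (auto simp: distrib_left distrib_right)

lemma half_line_conv_power_add:
  assumes [measurable]: "q \<in> borel_measurable borel" "f \<in> borel_measurable borel" "g \<in> borel_measurable borel"
  shows "(half_line_conv q ^^ n) (\<lambda>s. f s + g s) = (\<lambda>s. (half_line_conv q ^^ n) f s + (half_line_conv q ^^ n) g s)"
  by (induction n) (auto simp: half_line_conv_add)

lemma half_line_conv_suminf:
  assumes [measurable]: "q \<in> borel_measurable borel" "\<And>m. f m \<in> borel_measurable borel"
  shows "half_line_conv q (\<lambda>s. \<Sum>m. f m s) s = (\<Sum>m. half_line_conv q (f m) s)"
  unfolding half_line_conv_def
  by (subst nn_integral_suminf[symmetric]) (simp_all only: ennreal_suminf_multc ennreal_suminf_cmult, measurable)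

lemma half_line_conv_power_suminf:
  assumes [measurable]: "q \<in> borel_measurable borel" "\<And>m. f m \<in> borel_measurable borel"
  shows "(half_line_conv q ^^ n) (\<lambda>s. \<Sum>m. f m s) = (\<lambda>s. \<Sum>m. (half_line_conv q ^^ n) (f m) s)"
  by (induction n) (auto simp: half_line_conv_suminf)

text \<open>The \<open>n\<close>-fold iterate integrates over a simplex of volume
  \<open>s ^ n / fact n\<close>, on which each kernel is at most \<open>L\<close>.\<close>

lemma half_line_conv_power_bound:
  fixes C L :: real
  assumes q: "\<And>w. 0 \<le> w \<Longrightarrow> w \<le> t \<Longrightarrow> q w \<le> L" and f: "\<And>u. 0 \<le> u \<Longrightarrow> u \<le> t \<Longrightarrow> f u \<le> ennreal C"
    and [simp]: "0 \<le> C" "0 \<le> L" and s: "0 \<le> s" "s \<le> t"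
  shows "(half_line_conv q ^^ n) f s \<le> ennreal (C * (L * s) ^ n / fact n)"
  using s
proof (induction n arbitrary: s)
  case (Suc n)
  \<comment> \<open>\<open>F\<close> is an antiderivative in \<open>w\<close> of the majorant that
    the induction hypothesis gives for the integrand.\<close>
  define F where "F = (\<lambda>w. - (C * L ^ Suc n * (s - w) ^ Suc n / fact (Suc n)))"
  have "(half_line_conv q ^^ Suc n) f s =
      (\<integral>\<^sup>+w. ennreal (q w) * (half_line_conv q ^^ n) f (s - w) * indicator {0..s} w \<partial>lborel)"
    by (simp add: half_line_conv_def)
  also have "\<dots> \<le> (\<integral>\<^sup>+w. ennreal (L * (C * (L * (s - w)) ^ n / fact n)) * indicator {0..s} w \<partial>lborel)"
  proof (rule nn_integral_mono)
    fix w
    show "ennreal (q w) * (half_line_conv q ^^ n) f (s - w) * indicator {0..s} w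
      \<le> ennreal (L * (C * (L * (s - w)) ^ n / fact n)) * indicator {0..s} w"
    proof (cases "w \<in> {0..s}")
      case True
      then have "ennreal (q w) * (half_line_conv q ^^ n) f (s - w)
        \<le> ennreal L * ennreal (C * (L * (s - w)) ^ n / fact n)"
        using Suc.prems by (intro mult_mono Suc.IH ennreal_leI q) auto
      also have "\<dots> = ennreal (L * (C * (L * (s - w)) ^ n / fact n))"
        by (rule ennreal_mult'[symmetric]) simp
      finally show ?thesis using True by simp
    qed simp
  qed
  also have "\<dots> = ennreal (F s - F 0)"
  proof (rule nn_integral_FTC_Icc)
    fix w assume w: "w \<in> {0..s}"
    have "(F has_real_derivative C * L ^ Suc n * (real (Suc n) * (s - w) ^ n) / fact (Suc n)) (at w)"
      unfolding F_def
      by (rule DERIV_cong[OF DERIV_minus[OF DERIV_cdivide[OF DERIV_cmult[OF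
          DERIV_power_Suc[OF DERIV_diff[OF DERIV_const DERIV_ident]]]]]]) simp
    also have "C * L ^ Suc n * (real (Suc n) * (s - w) ^ n) / fact (Suc n) = L * (C * (L * (s - w)) ^ n / fact n)"
      by (simp only: power_mult_distrib) (simp add: field_simps del: of_nat_Suc)
    finally show "(F has_real_derivative L * (C * (L * (s - w)) ^ n / fact n)) (at w)" .
    show "0 \<le> L * (C * (L * (s - w)) ^ n / fact n)" using w by simp
  qed (use Suc.prems in auto)
  also have "F s - F 0 = C * (L * s) ^ Suc n / fact (Suc n)"
    by (simp add: F_def power_mult_distrib)
  finally show ?case .
qed (use f in simp)

lemma half_line_conv_power_tendsto_0:
  fixes C L :: real
  assumes "\<And>w. 0 \<le> w \<Longrightarrow> w \<le> s \<Longrightarrow> q w \<le> L" and "\<And>u. 0 \<le> u \<Longrightarrow> u \<le> s \<Longrightarrow> f u \<le> ennreal C"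
    and "0 \<le> C" "0 \<le> L" "0 \<le> s"
  shows "(\<lambda>n. (half_line_conv q ^^ n) f s) \<longlonglongrightarrow> 0"
proof (rule tendsto_sandwich[OF _ _ tendsto_const])
  have "(\<lambda>n. C * (inverse (fact n) * (L * s) ^ n)) \<longlonglongrightarrow> C * 0"
    by (intro tendsto_mult tendsto_const summable_LIMSEQ_zero summable_exp)
  then have "(\<lambda>n. ennreal (C * (inverse (fact n) * (L * s) ^ n))) \<longlonglongrightarrow> ennreal 0"
    by (intro tendsto_ennrealI) simp
  then show "(\<lambda>n. ennreal (C * (L * s) ^ n / fact n)) \<longlonglongrightarrow> 0"
    by (simp add: field_simps)
  show "\<forall>\<^sub>F n in sequentially. (half_line_conv q ^^ n) f s \<le> ennreal (C * (L * s) ^ n / fact n)"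
    using half_line_conv_power_bound[of s q L f C s] assms by (intro always_eventually allI) auto
qed auto

text \<open>Substituting the equation into itself \<open>N\<close> times leaves the
  \<open>N\<close>-th partial sum and a remainder, the \<open>N\<close>-fold convolution applied to
  \<open>f\<close>. The bounds on \<open>q\<close> and \<open>f\<close> force the remainder to
  0.\<close>

lemma renewal_series:
  fixes C L :: real
  assumes [measurable]: "q \<in> borel_measurable borel" "f \<in> borel_measurable borel" "g \<in> borel_measurable borel"
    and ren: "\<And>u. 0 \<le> u \<Longrightarrow> u \<le> s \<Longrightarrow> f u = g u + half_line_conv q f u"
    and bnd: "\<And>w. 0 \<le> w \<Longrightarrow> w \<le> s \<Longrightarrow> q w \<le> L" "\<And>u. 0 \<le> u \<Longrightarrow> u \<le> s \<Longrightarrow> f u \<le> ennreal C"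
    and nonneg: "0 \<le> C" "0 \<le> L" "0 \<le> s"
  shows "(\<Sum>m. (half_line_conv q ^^ m) g s) = f s"
proof -
  have partial: "(\<Sum>m<N. (half_line_conv q ^^ m) g s) + (half_line_conv q ^^ N) f s = f s" for N
  proof (induction N)
    case (Suc N)
    have "(half_line_conv q ^^ N) f s = (half_line_conv q ^^ N) (\<lambda>u. g u + half_line_conv q f u) s"
      by (rule half_line_conv_power_cong[of s]) (use ren nonneg in auto)
    also have "\<dots> = (half_line_conv q ^^ N) g s + (half_line_conv q ^^ Suc N) f s"
      by (subst half_line_conv_power_add) (auto simp: funpow_swap1)
    finally show ?case
      using Suc by (simp add: add.assoc)
  qed simp
  have "(\<lambda>N. (\<Sum>m<N. (half_line_conv q ^^ m) g s) + (half_line_conv q ^^ N) f s) \<longlonglongrightarrow>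
      (\<Sum>m. (half_line_conv q ^^ m) g s) + 0"
    by (intro tendsto_add half_line_conv_power_tendsto_0[OF bnd nonneg] summable_LIMSEQ) auto
  then show ?thesis
    unfolding partial by (simp add: LIMSEQ_const_iff)
qed

section \<open>The closed form of the mean: differential and renewal equation\<close>

definition mean_cosh_deriv :: "real \<Rightarrow> real \<Rightarrow> real \<Rightarrow> real" where
  "mean_cosh_deriv lam c s = 2 * c\<^sup>2 / sqrt (lam\<^sup>2 + 4 * c\<^sup>2) *
     (exp (- (lam * s / 2)) * sinh (s * sqrt (lam\<^sup>2 + 4 * c\<^sup>2) / 2))"

text \<open>The exponents (- lam +- sqrt (lam^2 + 4 c^2)) / 2 occurring in \<open>mean_cosh\<close>
  are the roots of x^2 + lam x = c^2. This is the source of the second-order equation E'' = c^2 E -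
  lam E'.\<close>

lemma DERIV_mean_cosh:
  assumes "0 < lam"
  shows "(mean_cosh lam c has_real_derivative mean_cosh_deriv lam c s) (at s)"
    and "(mean_cosh_deriv lam c has_real_derivative
      c\<^sup>2 * mean_cosh lam c s - lam * mean_cosh_deriv lam c s) (at s)"
proof -
  define r where "r = sqrt (lam\<^sup>2 + 4 * c\<^sup>2)"
  have "0 < lam\<^sup>2 + 4 * c\<^sup>2" using assms by (intro add_pos_nonneg) auto
  then have r: "0 < r" "r\<^sup>2 = lam\<^sup>2 + 4 * c\<^sup>2" by (simp_all add: r_def)
  have c2: "c\<^sup>2 = (r\<^sup>2 - lam\<^sup>2) / 4" using r(2) by simp
  define A B where "A = cosh (s * r / 2)" and "B = sinh (s * r / 2)"
  have "((\<lambda>s. exp (- (lam * s / 2)) * (cosh (s * r / 2) + lam / r * sinh (s * r / 2)))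
      has_real_derivative - (lam / 2) * exp (- (lam * s / 2)) * (A + lam / r * B) +
        (B * (r / 2) + lam / r * (A * (r / 2))) * exp (- (lam * s / 2))) (at s)"
    unfolding A_def B_def by (auto intro!: derivative_eq_intros) (simp add: algebra_simps)
  also have "- (lam / 2) * exp (- (lam * s / 2)) * (A + lam / r * B) +
        (B * (r / 2) + lam / r * (A * (r / 2))) * exp (- (lam * s / 2)) =
      2 * c\<^sup>2 / r * (exp (- (lam * s / 2)) * B)"
    using r(1) unfolding c2 by (simp add: field_simps power2_eq_square)
  finally show "(mean_cosh lam c has_real_derivative mean_cosh_deriv lam c s) (at s)"
    unfolding mean_cosh_def[abs_def] mean_cosh_deriv_def B_def r_def .
  have "((\<lambda>s. 2 * c\<^sup>2 / r * (exp (- (lam * s / 2)) * sinh (s * r / 2)))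
      has_real_derivative 2 * c\<^sup>2 / r * (- (lam / 2) * exp (- (lam * s / 2)) * B +
        A * (r / 2) * exp (- (lam * s / 2)))) (at s)"
    using r(1) unfolding A_def B_def by (auto intro!: derivative_eq_intros)
  also have "2 * c\<^sup>2 / r * (- (lam / 2) * exp (- (lam * s / 2)) * B +
        A * (r / 2) * exp (- (lam * s / 2))) =
      c\<^sup>2 * (exp (- (lam * s / 2)) * (A + lam / r * B)) -
        lam * (2 * c\<^sup>2 / r * (exp (- (lam * s / 2)) * B))"
    using r(1) by (simp add: field_simps power2_eq_square)
  finally show "(mean_cosh_deriv lam c has_real_derivative
      c\<^sup>2 * mean_cosh lam c s - lam * mean_cosh_deriv lam c s) (at s)"
    unfolding mean_cosh_def mean_cosh_deriv_def[abs_def] A_def B_def r_def .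
qed

lemma mean_cosh_nonneg:
  assumes "0 < lam" "0 \<le> s"
  shows "0 \<le> mean_cosh lam c s"
  using assms unfolding mean_cosh_def
  by (intro mult_nonneg_nonneg add_nonneg_nonneg divide_nonneg_nonneg) auto

lemma continuous_on_mean_cosh: "continuous_on S (mean_cosh lam c)"
proof -
  have "continuous_on S (\<lambda>s. exp (- (lam * s / 2)) * (cosh (s * r / 2) + k * sinh (s * r / 2)))"
    for r k :: real
    by (auto intro!: continuous_intros)
  then show ?thesis
    unfolding mean_cosh_def[abs_def] .
qed

lemma mean_cosh_measurable [measurable]: "mean_cosh lam c \<in> borel_measurable borel"
  by (intro borel_measurable_continuous_onI continuous_on_mean_cosh)

lemma cosh_measurable [measurable]: "(cosh :: real \<Rightarrow> real) \<in> borel_measurable borel"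
  by (intro borel_measurable_continuous_onI continuous_intros)

text \<open>This conditions on the first waiting time: either none ends before \<open>s\<close>, or
  one of length \<open>w\<close> does and the motion goes on for \<open>s - w\<close>. The
  convolution integral is evaluated by an explicit antiderivative.\<close>

lemma mean_cosh_renewal:
  assumes lam: "0 < lam" and c: "0 < c" and s: "0 \<le> s"
  shows "ennreal (mean_cosh lam c s) = ennreal (exp (- lam * s) * cosh (c * s)) +
    half_line_conv (\<lambda>w. lam * exp (- lam * w) * cosh (c * w)) (\<lambda>s. ennreal (mean_cosh lam c s)) s"
proof -
  \<comment> \<open>The combination of \<open>cosh\<close> and \<open>sinh\<close> is chosen so
    that, by the differential equation, all terms of the derivative other than \<open>f w\<close>
    cancel. E(0) = 1 and E'(0) = 0 give the value at \<open>w = s\<close>.\<close>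
  define F where "F = (\<lambda>w. - (exp (- lam * w) *
    (cosh (c * w) * mean_cosh lam c (s - w) + sinh (c * w) * mean_cosh_deriv lam c (s - w) / c)))"
  define f where "f = (\<lambda>w. lam * exp (- lam * w) * cosh (c * w) * mean_cosh lam c (s - w))"
  have F: "(F has_real_derivative f w) (at w within S)" for w S
  proof -
    have "((\<lambda>w. - (exp (- lam * w) *
        (cosh (c * w) * mean_cosh lam c (s - w) + sinh (c * w) * mean_cosh_deriv lam c (s - w) / c)))
      has_real_derivative
        lam * exp (- lam * w) * (cosh (c * w) * mean_cosh lam c (s - w) + sinh (c * w) * mean_cosh_deriv lam c (s - w) / c) -
        exp (- lam * w) * (c * sinh (c * w) * mean_cosh lam c (s - w) - cosh (c * w) * mean_cosh_deriv lam c (s - w)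
          + (c * cosh (c * w) * mean_cosh_deriv lam c (s - w) -
             sinh (c * w) * (c\<^sup>2 * mean_cosh lam c (s - w) - lam * mean_cosh_deriv lam c (s - w))) / c)) (at w within S)"
      by (rule derivative_eq_intros DERIV_chain2[OF DERIV_mean_cosh(1)[OF lam]]
          DERIV_chain2[OF DERIV_mean_cosh(2)[OF lam]] refl | use c in \<open>simp; fail\<close>)+
        (use c in \<open>simp add: field_simps\<close>)
    then show ?thesis
      unfolding F_def f_def by (rule DERIV_cong) (use c in \<open>simp add: field_simps power2_eq_square\<close>)
  qed
  have fnn: "0 \<le> f w" if "w \<in> {0..s}" for w
    using that lam mean_cosh_nonneg[OF lam, of "s - w" c] by (simp add: f_def)
  have "half_line_conv (\<lambda>w. lam * exp (- lam * w) * cosh (c * w)) (\<lambda>s. ennreal (mean_cosh lam c s)) s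
    = (\<integral>\<^sup>+w. ennreal (f w) * indicator {0..s} w \<partial>lborel)"
    unfolding half_line_conv_def using lam
    by (intro nn_integral_cong) (auto simp: f_def ennreal_mult' split: split_indicator)
  also have "\<dots> = ennreal (F s - F 0)"
    by (rule nn_integral_FTC_Icc) (use F fnn s in \<open>auto simp: f_def\<close>)
  also have "F s - F 0 = mean_cosh lam c s - exp (- lam * s) * cosh (c * s)"
    by (simp add: F_def mean_cosh_def mean_cosh_deriv_def)
  finally have "half_line_conv (\<lambda>w. lam * exp (- lam * w) * cosh (c * w)) (\<lambda>s. ennreal (mean_cosh lam c s)) s
    = ennreal (mean_cosh lam c s - exp (- lam * s) * cosh (c * s))" .
  \<comment> \<open>\<open>ennreal\<close> sends negative reals to 0, so the difference has to be
    nonnegative before it can be moved to the other side.\<close>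
  moreover have "0 \<le> F s - F 0"
    by (rule DERIV_nonneg_imp_nondecreasing[of 0 s F, THEN diff_ge_0_iff_ge[THEN iffD2]])
      (use s F fnn in auto)
  then have "exp (- lam * s) * cosh (c * s) \<le> mean_cosh lam c s"
    by (simp add: F_def mean_cosh_def mean_cosh_deriv_def)
  ultimately show ?thesis
    by (simp add: ennreal_plus[symmetric] del: ennreal_plus)
qed

section \<open>Iterated integrals\<close>

lemma continuous_on_iterated_integral:
  assumes f: "continuous_on {a..t} f"
  shows "continuous_on {a..t} (iterated_integral k f t)"
proof (induction k)
  case 0
  have "iterated_integral 0 f t = f" by auto
  with f show ?case by simp
next
  case (Suc k)
  have "iterated_integral (Suc k) f t = (\<lambda>u. integral {u..t} (iterated_integral k f t))" by auto
  with DERIV_continuous_on[OF integral_has_real_derivative'[OF Suc]] show ?case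
    by simp
qed

lemma DERIV_iterated_integral:
  assumes f: "continuous_on {a..t} f" and s: "s \<in> {a..t}"
  shows "(iterated_integral (Suc k) f t has_real_derivative - iterated_integral k f t s) (at s within {a..t})"
proof -
  have "iterated_integral (Suc k) f t = (\<lambda>u. integral {u..t} (iterated_integral k f t))" by auto
  then show ?thesis
    using integral_has_real_derivative'[OF continuous_on_iterated_integral[OF f] s] by simp
qed

lemma iterated_integral_nonneg:
  assumes f: "continuous_on {a..t} f" and nn: "\<And>u. u \<in> {a..t} \<Longrightarrow> 0 \<le> f u" and s: "s \<in> {a..t}"
  shows "0 \<le> iterated_integral k f t s"
  using s
proof (induction k arbitrary: s)
  case (Suc k)
  have "continuous_on {s..t} (iterated_integral k f t)"
    by (rule continuous_on_subset[OF continuous_on_iterated_integral[OF f]]) (use Suc.prems in auto)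
  then show ?case
    using Suc by (auto intro!: integral_nonneg integrable_continuous_real)
qed (use nn in simp)

text \<open>
  Integration by parts trades one iterated integration for one power of the integration variable;
  the boundary terms vanish at both ends.
\<close>

lemma integral_power_iterated_integral:
  assumes f: "continuous_on {a..t} f" and "a \<le> t"
  shows "integral {a..t} (\<lambda>s. (s - a) ^ j / fact j * iterated_integral (Suc k) f t s) =
    integral {a..t} (\<lambda>s. (s - a) ^ Suc j / fact (Suc j) * iterated_integral k f t s)"
proof -
  have "((\<lambda>s. (s - a) ^ j / fact j * iterated_integral (Suc k) f t s -
        (s - a) ^ Suc j / fact (Suc j) * iterated_integral k f t s) has_integral
      (t - a) ^ Suc j / fact (Suc j) * iterated_integral (Suc k) f t t -
      (a - a) ^ Suc j / fact (Suc j) * iterated_integral (Suc k) f t a) {a..t}"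
  proof (rule fundamental_theorem_of_calculus)
    fix s assume s: "s \<in> {a..t}"
    have "((\<lambda>s. (s - a) ^ Suc j / fact (Suc j)) has_real_derivative (s - a) ^ j / fact j) (at s within {a..t})"
      by (rule DERIV_cong[OF DERIV_cdivide[OF DERIV_power_Suc[OF DERIV_diff[OF DERIV_ident DERIV_const]]]])
        (simp add: divide_simps)
    from DERIV_mult[OF this DERIV_iterated_integral[OF f s, of k]]
    show "((\<lambda>s. (s - a) ^ Suc j / fact (Suc j) * iterated_integral (Suc k) f t s) has_vector_derivative
      (s - a) ^ j / fact j * iterated_integral (Suc k) f t s -
        (s - a) ^ Suc j / fact (Suc j) * iterated_integral k f t s) (at s within {a..t})"
      unfolding has_real_derivative_iff_has_vector_derivative[symmetric]
      by (rule DERIV_cong) (simp add: mult.commute)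
  qed (use assms in simp)
  then have "integral {a..t} (\<lambda>s. (s - a) ^ j / fact j * iterated_integral (Suc k) f t s -
        (s - a) ^ Suc j / fact (Suc j) * iterated_integral k f t s) = 0"
    by (simp add: integral_unique del: fact_Suc power_Suc)
  moreover have "integral {a..t} (\<lambda>s. (s - a) ^ j / fact j * iterated_integral (Suc k) f t s -
        (s - a) ^ Suc j / fact (Suc j) * iterated_integral k f t s) =
      integral {a..t} (\<lambda>s. (s - a) ^ j / fact j * iterated_integral (Suc k) f t s) -
      integral {a..t} (\<lambda>s. (s - a) ^ Suc j / fact (Suc j) * iterated_integral k f t s)"
    by (intro Henstock_Kurzweil_Integration.integral_diff integrable_continuous_real continuous_on_mult
        continuous_on_iterated_integral f continuous_intros) auto
  ultimately show ?thesis by simp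
qed

text \<open>Cauchy's formula for repeated integration. The induction is on the number
  \<open>j\<close> of integrations already traded for powers, with the number \<open>i\<close> of
  remaining ones arbitrary.\<close>

lemma iterated_integral_Suc_eq:
  assumes f: "continuous_on {a..t} f" and "a \<le> t"
  shows "iterated_integral (Suc k) f t a = integral {a..t} (\<lambda>s. (s - a) ^ k / fact k * f s)"
proof -
  have "iterated_integral (Suc (j + i)) f t a =
      integral {a..t} (\<lambda>s. (s - a) ^ j / fact j * iterated_integral i f t s)" for i j
  proof (induction j arbitrary: i)
    case (Suc j)
    from Suc[of "Suc i"] show ?case
      using integral_power_iterated_integral[OF assms, of j i] by simp
  qed simp
  from this[of k 0] show ?thesis by simp
qed

text \<open>The substitution \<open>s = a + w\<close> turns waiting times into event times. The
  exponential factors of successive waiting times multiply to one that depends on the last event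
  time only; \<open>exp (lam * (t - s))\<close> in the integrand compensates for extending it to all
  of \<open>t - a\<close>.\<close>

lemma half_line_conv_power_exponential:
  assumes lam: "0 < lam" and t: "0 \<le> t"
    and f: "continuous_on {0..t} f" and nn: "\<And>u. u \<in> {0..t} \<Longrightarrow> 0 \<le> f u" and a: "a \<in> {0..t}"
  shows "(half_line_conv (\<lambda>w. lam * exp (- lam * w)) ^^ k) (\<lambda>s. ennreal (f s)) (t - a) =
    ennreal (lam ^ k * exp (- lam * (t - a)) *
      iterated_integral k (\<lambda>s. exp (lam * (t - s)) * f (t - s)) t a)"
  using a
proof (induction k arbitrary: a)
  case 0
  then show ?case by (simp add: mult.assoc[symmetric] exp_add[symmetric])
next
  case (Suc k)
  define I where "I = (\<lambda>k. iterated_integral k (\<lambda>s. exp (lam * (t - s)) * f (t - s)) t)"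
  have cont: "continuous_on {a..t} (\<lambda>s. exp (lam * (t - s)) * f (t - s))"
    using Suc.prems by (auto intro!: continuous_intros continuous_on_compose2[OF f])
  have contI: "continuous_on {a..t} (I k)"
    unfolding I_def by (rule continuous_on_iterated_integral[OF cont])
  have Inn: "0 \<le> I j s" if "s \<in> {a..t}" for s j
    unfolding I_def by (rule iterated_integral_nonneg[OF cont _ that]) (use nn Suc.prems in auto)
  define C where "C = lam ^ Suc k * exp (- lam * (t - a))"
  have "0 \<le> C" using lam by (simp add: C_def)
  have "(half_line_conv (\<lambda>w. lam * exp (- lam * w)) ^^ Suc k) (\<lambda>s. ennreal (f s)) (t - a) =
    (\<integral>\<^sup>+w. ennreal (lam * exp (- lam * w)) *
      (half_line_conv (\<lambda>w. lam * exp (- lam * w)) ^^ k) (\<lambda>s. ennreal (f s)) (t - a - w) *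
      indicator {0..t - a} w \<partial>lborel)"
    by (simp add: half_line_conv_def)
  \<comment> \<open>The argument is written \<open>a + 1 * w\<close> to fit the affine substitution
    that follows.\<close>
  also have "\<dots> = (\<integral>\<^sup>+w. ennreal (C * (I k (a + 1 * w) * indicator {a..t} (a + 1 * w))) \<partial>lborel)"
  proof (rule nn_integral_cong)
    fix w
    show "ennreal (lam * exp (- lam * w)) *
      (half_line_conv (\<lambda>w. lam * exp (- lam * w)) ^^ k) (\<lambda>s. ennreal (f s)) (t - a - w) *
      indicator {0..t - a} w = ennreal (C * (I k (a + 1 * w) * indicator {a..t} (a + 1 * w)))"
    proof (cases "w \<in> {0..t - a}")
      case True
      then have mem: "a + w \<in> {0..t}" using Suc.prems by auto
      have "lam * exp (- lam * w) * (lam ^ k * exp (- lam * (t - (a + w))) * I k (a + w)) = C * I k (a + w)"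
        by (simp add: C_def exp_minus exp_diff exp_add algebra_simps)
      then have "ennreal (lam * exp (- lam * w)) * ennreal (lam ^ k * exp (- lam * (t - (a + w))) * I k (a + w))
        = ennreal (C * I k (a + w))"
        using lam by (subst ennreal_mult'[symmetric]) (simp, simp only:)
      with Suc.IH[OF mem] True show ?thesis
        unfolding I_def[THEN fun_cong, of k, THEN fun_cong, of "a + w", symmetric] diff_diff_eq
        by simp
    qed (use Suc.prems in \<open>auto split: split_indicator\<close>)
  qed
  also have "\<dots> = (\<integral>\<^sup>+s. ennreal (C * (I k s * indicator {a..t} s)) \<partial>lborel)"
  proof -
    have "(\<lambda>s. I k s * indicator {a..t} s) \<in> borel_measurable borel"
      using borel_measurable_continuous_on_indicator[OF _ contI] by (simp add: mult.commute)
    then show ?thesis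
      by (subst (2) nn_integral_real_affine[where c = 1 and t = a]) auto
  qed
  also have "\<dots> = ennreal C * ennreal (I (Suc k) a)"
  proof -
    have m: "(\<lambda>s. I k s * indicator {a..t} s) \<in> borel_measurable borel"
      using borel_measurable_continuous_on_indicator[OF _ contI] by (simp add: mult.commute)
    have "(I k has_integral I (Suc k) a) {a..t}"
      using integrable_integral[OF integrable_continuous_real[OF contI]] by (simp add: I_def)
    then have "((\<lambda>s. I k s * indicator {a..t} s) has_integral I (Suc k) a) {a..t}"
      by (rule has_integral_eq[rotated]) simp
    then have "((\<lambda>s. I k s * indicator {a..t} s) has_integral I (Suc k) a) UNIV"
      by (rule has_integral_on_superset) (auto simp: indicator_def)
    with m have "(\<integral>\<^sup>+s. ennreal (I k s * indicator {a..t} s) \<partial>lborel) = ennreal (I (Suc k) a)"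
      by (intro nn_integral_has_integral_lborel) (auto split: split_indicator intro: Inn)
    then show ?thesis
      using m \<open>0 \<le> C\<close> by (simp add: ennreal_mult' nn_integral_cmult)
  qed
  also have "\<dots> = ennreal (C * I (Suc k) a)"
    using \<open>0 \<le> C\<close> by (simp add: ennreal_mult')
  finally show ?case
    by (simp only: C_def I_def)
qed

section \<open>The event times\<close>

lemma count_strict_mono:
  fixes T :: "nat \<Rightarrow> real"
  assumes "strict_mono T" "T n \<le> t" "t < T (Suc n)"
  shows "card {i. 1 \<le> i \<and> T i \<le> t} = n"
proof -
  have "{i. 1 \<le> i \<and> T i \<le> t} = {1..n}"
  proof (intro set_eqI iffI)
    fix i assume "i \<in> {i. 1 \<le> i \<and> T i \<le> t}"
    with assms(3) have "1 \<le> i" "T i < T (Suc n)" by auto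
    then show "i \<in> {1..n}" using strict_mono_less[OF assms(1)] by auto
  next
    fix i assume "i \<in> {1..n}"
    then have "T i \<le> T n" using strict_mono_less_eq[OF assms(1)] by auto
    with \<open>i \<in> {1..n}\<close> assms(2) show "i \<in> {i. 1 \<le> i \<and> T i \<le> t}" by auto
  qed
  then show ?thesis by simp
qed

lemma nn_integral_exponential_tail:
  assumes "0 < l" "0 \<le> s"
  shows "(\<integral>\<^sup>+w. ennreal (exponential_density l w) * indicator {s<..} w \<partial>lborel) = ennreal (exp (- l * s))"
proof -
  have "(\<integral>\<^sup>+w. ennreal (exponential_density l w) * indicator {s<..} w \<partial>lborel) =
      (\<integral>\<^sup>+w. ennreal (l * exp (- l * w)) * indicator {s..} w \<partial>lborel)"
  proof (rule nn_integral_cong_AE)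
    show "AE w in lborel. ennreal (exponential_density l w) * indicator {s<..} w =
        ennreal (l * exp (- l * w)) * indicator {s..} w"
      using AE_lborel_singleton[of s]
      by eventually_elim
        (use assms in \<open>auto simp: exponential_density_def mult.commute split: split_indicator\<close>)
  qed
  also have "\<dots> = ennreal (0 - - exp (- l * s))"
  proof (rule nn_integral_FTC_atLeast)
    show "((\<lambda>w. - exp (- l * w)) \<longlongrightarrow> 0) at_top"
      using assms(1) by real_asymp
  qed (use assms in \<open>auto intro!: derivative_eq_intros\<close>)
  finally show ?thesis by simp
qed

section \<open>Integrating out the exponential waiting times\<close>

context poisson_turning
begin

abbreviation waiting :: "nat \<Rightarrow> 'a \<Rightarrow> real" where
  "waiting n \<omega> \<equiv> T (Suc n) \<omega> - T n \<omega>"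

lemma waiting_measurable [measurable]: "waiting n \<in> borel_measurable M"
  using distributed_measurable[OF waiting_time[of n]] by simp

lemma event_time_eq_sum: "\<omega> \<in> space M \<Longrightarrow> T n \<omega> = (\<Sum>j<n. waiting j \<omega>)"
  using sum_lessThan_telescope[of "\<lambda>j. T j \<omega>" n] by (simp add: T_0)

lemma event_time_measurable [measurable]: "T n \<in> borel_measurable M"
proof -
  have "(\<lambda>\<omega>. \<Sum>j<n. waiting j \<omega>) \<in> borel_measurable M" by measurable
  then show ?thesis
    by (rule measurable_cong[THEN iffD2, rotated]) (rule event_time_eq_sum)
qed

lemma event_count_measurable [measurable]: "event_count T t \<in> measurable M (count_space UNIV)"
  unfolding event_count_def[abs_def]
proof (rule measurable_card)
  fix i
  have "{\<omega> \<in> space M. 1 \<le> i \<and> T i \<omega> \<le> t} \<in> sets M" by measurable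
  then show "{\<omega> \<in> space M. i \<in> {n. 1 \<le> n \<and> T n \<omega> \<le> t}} \<in> sets M" by simp
qed

text \<open>The waiting time with index \<open>n\<close> is independent of the earlier ones and
  hence of \<open>T n\<close>, their sum. By Tonelli it can be integrated first, against its
  exponential density.\<close>

lemma nn_integral_next_waiting:
  fixes q :: "nat \<Rightarrow> real \<Rightarrow> real" and g :: "real \<Rightarrow> real \<Rightarrow> ennreal"
  assumes [measurable]: "\<And>j. q j \<in> borel_measurable borel" "case_prod g \<in> borel_measurable (borel \<Otimes>\<^sub>M borel)"
  shows "(\<integral>\<^sup>+\<omega>. ennreal (\<Prod>j<n. q j (waiting j \<omega>)) * g (T n \<omega>) (waiting n \<omega>) \<partial>M) =
    (\<integral>\<^sup>+\<omega>. ennreal (\<Prod>j<n. q j (waiting j \<omega>)) *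
      (\<integral>\<^sup>+w. ennreal (exponential_density lam w) * g (T n \<omega>) w \<partial>lborel) \<partial>M)"
proof -
  \<comment> \<open>In the independent family \<open>Inl\<close> indexes waiting times and
    \<open>Inr\<close> directions. \<open>X\<close> and \<open>Y\<close> collect the disjoint blocks
    of the first \<open>n\<close> waiting times and the next one; \<open>G\<close> is the integrand
    in terms of these blocks.\<close>
  let ?Z = "case_sum waiting e"
  let ?P = "PiM (Inl ` {..<n}) (\<lambda>_. borel :: real measure) :: (nat + nat \<Rightarrow> real) measure"
  let ?Q = "PiM {Inl n} (\<lambda>_. borel :: real measure) :: (nat + nat \<Rightarrow> real) measure"
  define X where "X = (\<lambda>\<omega>. restrict (\<lambda>i. ?Z i \<omega>) (Inl ` {..<n}))"
  define Y where "Y = (\<lambda>\<omega>. restrict (\<lambda>i. ?Z i \<omega>) {Inl n :: nat + nat})"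
  define G where "G = (\<lambda>(x :: nat + nat \<Rightarrow> real) (y :: nat + nat \<Rightarrow> real). ennreal (\<Prod>j<n. q j (x (Inl j))) *
    g (\<Sum>j<n. x (Inl j)) (y (Inl n)))"
  have ind: "indep_var ?P X ?Q Y"
    unfolding X_def Y_def by (rule indep_var_restrict[OF indep]) auto
  have X [measurable]: "X \<in> measurable M ?P" and Y [measurable]: "Y \<in> measurable M ?Q"
    using indep_var_rv1[OF ind] indep_var_rv2[OF ind] by auto
  have comp: "(\<lambda>x. x (Inl j)) \<in> borel_measurable ?P" if "j < n" for j
    using that by (intro measurable_component_singleton) auto
  have [measurable]: "(\<lambda>x. \<Prod>j<n. q j (x (Inl j))) \<in> borel_measurable ?P"
    by (intro borel_measurable_prod measurable_compose[OF comp]) auto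
  have [measurable]: "(\<lambda>x. \<Sum>j<n. x (Inl j)) \<in> borel_measurable ?P"
    by (intro borel_measurable_sum comp) auto
  have [measurable]: "(\<lambda>y. y (Inl n)) \<in> borel_measurable ?Q"
    by (intro measurable_component_singleton) auto
  have G [measurable]: "case_prod G \<in> borel_measurable (?P \<Otimes>\<^sub>M ?Q)"
    unfolding G_def by measurable
  have GX: "G (X \<omega>) y = ennreal (\<Prod>j<n. q j (waiting j \<omega>)) * g (T n \<omega>) (y (Inl n))"
    if "\<omega> \<in> space M" for \<omega> y
    using event_time_eq_sum[OF that, of n, symmetric] by (simp add: G_def X_def)
  have YW: "Y \<omega> (Inl n) = waiting n \<omega>" for \<omega>
    by (simp add: Y_def)
  interpret DY: prob_space "distr M ?Q Y"
    by (rule prob_space_distr) (rule Y)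
  have "(\<integral>\<^sup>+\<omega>. ennreal (\<Prod>j<n. q j (waiting j \<omega>)) * g (T n \<omega>) (waiting n \<omega>) \<partial>M) =
      (\<integral>\<^sup>+\<omega>. case_prod G (X \<omega>, Y \<omega>) \<partial>M)"
    by (intro nn_integral_cong) (simp add: GX YW)
  also have "\<dots> = (\<integral>\<^sup>+z. case_prod G z \<partial>distr M (?P \<Otimes>\<^sub>M ?Q) (\<lambda>\<omega>. (X \<omega>, Y \<omega>)))"
    by (rule nn_integral_distr[symmetric]) measurable
  also have "distr M (?P \<Otimes>\<^sub>M ?Q) (\<lambda>\<omega>. (X \<omega>, Y \<omega>)) = distr M ?P X \<Otimes>\<^sub>M distr M ?Q Y"
    using ind unfolding indep_var_distribution_eq by simp
  also have "(\<integral>\<^sup>+z. case_prod G z \<partial>(distr M ?P X \<Otimes>\<^sub>M distr M ?Q Y)) =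
      (\<integral>\<^sup>+x. \<integral>\<^sup>+y. G x y \<partial>distr M ?Q Y \<partial>distr M ?P X)"
    by (subst DY.nn_integral_fst[symmetric]) simp_all
  also have "\<dots> = (\<integral>\<^sup>+\<omega>. \<integral>\<^sup>+y. G (X \<omega>) y \<partial>distr M ?Q Y \<partial>M)"
    by (rule nn_integral_distr) measurable
  also have "\<dots> = (\<integral>\<^sup>+\<omega>. ennreal (\<Prod>j<n. q j (waiting j \<omega>)) *
      (\<integral>\<^sup>+w. ennreal (exponential_density lam w) * g (T n \<omega>) w \<partial>lborel) \<partial>M)"
  proof (rule nn_integral_cong)
    fix \<omega> assume \<omega>: "\<omega> \<in> space M"
    have "(\<integral>\<^sup>+y. G (X \<omega>) y \<partial>distr M ?Q Y) =
        (\<integral>\<^sup>+\<omega>'. ennreal (\<Prod>j<n. q j (waiting j \<omega>)) * g (T n \<omega>) (waiting n \<omega>') \<partial>M)"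
      unfolding GX[OF \<omega>] by (subst nn_integral_distr[OF Y]) (measurable, simp only: YW)
    also have "\<dots> = ennreal (\<Prod>j<n. q j (waiting j \<omega>)) * (\<integral>\<^sup>+\<omega>'. g (T n \<omega>) (waiting n \<omega>') \<partial>M)"
      by (rule nn_integral_cmult) measurable
    also have "(\<integral>\<^sup>+\<omega>'. g (T n \<omega>) (waiting n \<omega>') \<partial>M) =
        (\<integral>\<^sup>+w. ennreal (exponential_density lam w) * g (T n \<omega>) w \<partial>lborel)"
      by (rule distributed_nn_integral[OF waiting_time[of n], of "g (T n \<omega>)", symmetric])
        (use measurable_Pair2[OF assms(2), of "T n \<omega>"] in simp)
    finally show "(\<integral>\<^sup>+y. G (X \<omega>) y \<partial>distr M ?Q Y) = ennreal (\<Prod>j<n. q j (waiting j \<omega>)) *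
        (\<integral>\<^sup>+w. ennreal (exponential_density lam w) * g (T n \<omega>) w \<partial>lborel)" .
  qed
  finally show ?thesis .
qed

text \<open>Integrating out the last waiting time produces one convolution. That \<open>f\<close>
  vanishes at negative times restricts the waiting time to the interval of
  \<open>half_line_conv\<close>.\<close>

lemma nn_integral_weighted_Suc:
  fixes q :: "nat \<Rightarrow> real \<Rightarrow> real"
  assumes lam: "0 < lam"
    and [measurable]: "\<And>j. q j \<in> borel_measurable borel" "f \<in> borel_measurable borel"
    and q: "\<And>j w. 0 \<le> q j w" and f: "\<And>s. s < 0 \<Longrightarrow> f s = 0"
  shows "(\<integral>\<^sup>+\<omega>. ennreal (\<Prod>j<Suc n. q j (waiting j \<omega>)) * f (t - T (Suc n) \<omega>) \<partial>M) =
    (\<integral>\<^sup>+\<omega>. ennreal (\<Prod>j<n. q j (waiting j \<omega>)) *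
      half_line_conv (\<lambda>w. lam * exp (- lam * w) * q n w) f (t - T n \<omega>) \<partial>M)"
proof -
  have "(\<integral>\<^sup>+\<omega>. ennreal (\<Prod>j<Suc n. q j (waiting j \<omega>)) * f (t - T (Suc n) \<omega>) \<partial>M) =
    (\<integral>\<^sup>+\<omega>. ennreal (\<Prod>j<n. q j (waiting j \<omega>)) *
      (\<lambda>a w. ennreal (q n w) * f (t - a - w)) (T n \<omega>) (waiting n \<omega>) \<partial>M)"
    by (intro nn_integral_cong) (simp add: q prod_nonneg ennreal_mult mult.assoc diff_diff_eq)
  also have "\<dots> = (\<integral>\<^sup>+\<omega>. ennreal (\<Prod>j<n. q j (waiting j \<omega>)) *
      (\<integral>\<^sup>+w. ennreal (exponential_density lam w) * (ennreal (q n w) * f (t - T n \<omega> - w)) \<partial>lborel) \<partial>M)"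
    by (rule nn_integral_next_waiting) measurable
  also have "\<dots> = (\<integral>\<^sup>+\<omega>. ennreal (\<Prod>j<n. q j (waiting j \<omega>)) *
      half_line_conv (\<lambda>w. lam * exp (- lam * w) * q n w) f (t - T n \<omega>) \<partial>M)"
  proof (rule nn_integral_cong)
    fix \<omega>
    have "(\<integral>\<^sup>+w. ennreal (exponential_density lam w) * (ennreal (q n w) * f (t - T n \<omega> - w)) \<partial>lborel) =
      half_line_conv (\<lambda>w. lam * exp (- lam * w) * q n w) f (t - T n \<omega>)"
      unfolding half_line_conv_def
    proof (rule nn_integral_cong)
      fix w
      have "ennreal (lam * exp (- lam * w) * q n w) = ennreal (lam * exp (- lam * w)) * ennreal (q n w)"
        using lam q by (intro ennreal_mult) auto
      then show "ennreal (exponential_density lam w) * (ennreal (q n w) * f (t - T n \<omega> - w)) =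
        ennreal (lam * exp (- lam * w) * q n w) * f (t - T n \<omega> - w) * indicator {0..t - T n \<omega>} w"
        using f[of "t - T n \<omega> - w"]
        by (auto simp: exponential_density_def mult_ac split: split_indicator)
    qed
    then show "ennreal (\<Prod>j<n. q j (waiting j \<omega>)) *
      (\<integral>\<^sup>+w. ennreal (exponential_density lam w) * (ennreal (q n w) * f (t - T n \<omega> - w)) \<partial>lborel) =
      ennreal (\<Prod>j<n. q j (waiting j \<omega>)) *
      half_line_conv (\<lambda>w. lam * exp (- lam * w) * q n w) f (t - T n \<omega>)"
      by simp
  qed
  finally show ?thesis .
qed

lemma half_line_conv_negative: "s < 0 \<Longrightarrow> half_line_conv q f s = 0"
  by (simp add: half_line_conv_def)

text \<open>Each induction step removes the last waiting time and replaces \<open>f\<close> by its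
  convolution, so \<open>f\<close> has to be arbitrary.\<close>

lemma nn_integral_event_time:
  assumes lam: "0 < lam" and [measurable]: "f \<in> borel_measurable borel" and f: "\<And>s. s < 0 \<Longrightarrow> f s = 0"
  shows "(\<integral>\<^sup>+\<omega>. f (t - T n \<omega>) \<partial>M) = (half_line_conv (\<lambda>w. lam * exp (- lam * w)) ^^ n) f t"
  using assms(2,3)
proof (induction n arbitrary: f)
  case 0
  have "(\<integral>\<^sup>+\<omega>. f (t - T 0 \<omega>) \<partial>M) = (\<integral>\<^sup>+\<omega>. f t \<partial>M)"
    by (intro nn_integral_cong) (simp add: T_0)
  then show ?case by (simp add: emeasure_space_1)
next
  case (Suc n)
  note [measurable] = Suc.prems(1)
  have "(\<integral>\<^sup>+\<omega>. f (t - T (Suc n) \<omega>) \<partial>M) = (\<integral>\<^sup>+\<omega>. half_line_conv (\<lambda>w. lam * exp (- lam * w)) f (t - T n \<omega>) \<partial>M)"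
    using nn_integral_weighted_Suc[OF lam, of "\<lambda>_ _. 1" f n t] Suc.prems by simp
  also have "\<dots> = (half_line_conv (\<lambda>w. lam * exp (- lam * w)) ^^ n) (half_line_conv (\<lambda>w. lam * exp (- lam * w)) f) t"
    by (rule Suc.IH) (auto simp: half_line_conv_negative)
  finally show ?case by (simp add: funpow_swap1)
qed

text \<open>The waiting times after the \<open>k\<close>-th event carry the weight and are removed
  first, so their operator acts innermost; the \<open>k\<close> earlier ones contribute the plain
  exponential kernel.\<close>

lemma nn_integral_weighted_event_time:
  assumes lam: "0 < lam" and [measurable]: "q \<in> borel_measurable borel" "f \<in> borel_measurable borel"
    and q: "\<And>w. 0 \<le> q w" and f: "\<And>s. s < 0 \<Longrightarrow> f s = 0"
  shows "(\<integral>\<^sup>+\<omega>. ennreal (\<Prod>j=k..<k + m. q (waiting j \<omega>)) * f (t - T (k + m) \<omega>) \<partial>M) =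
    (half_line_conv (\<lambda>w. lam * exp (- lam * w)) ^^ k)
      ((half_line_conv (\<lambda>w. lam * exp (- lam * w) * q w) ^^ m) f) t"
  using assms(3,5)
proof (induction m arbitrary: f)
  case 0
  then show ?case using nn_integral_event_time[OF lam] by simp
next
  case (Suc m)
  note [measurable] = Suc.prems(1)
  \<comment> \<open>Weight 1 before the \<open>k\<close>-th event extends the product to all indices
    from 0.\<close>
  define p where "p = (\<lambda>j. if j < k then (\<lambda>_. 1) else q)"
  have [measurable]: "p j \<in> borel_measurable borel" for j by (simp add: p_def)
  have p0: "0 \<le> p j w" for j w by (simp add: p_def q)
  have p: "(\<Prod>j<k + i. p j (waiting j \<omega>)) = (\<Prod>j=k..<k + i. q (waiting j \<omega>))" for i :: nat and \<omega>
  proof -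
    have "(\<Prod>j<k + i. p j (waiting j \<omega>)) = (\<Prod>j<k. p j (waiting j \<omega>)) * (\<Prod>j=k..<k + i. p j (waiting j \<omega>))"
      unfolding lessThan_atLeast0 by (rule prod.atLeastLessThan_concat[symmetric]) auto
    then show ?thesis by (simp add: p_def)
  qed
  have pk: "p (k + m) = q" by (simp add: p_def)
  have "(\<integral>\<^sup>+\<omega>. ennreal (\<Prod>j=k..<k + Suc m. q (waiting j \<omega>)) * f (t - T (k + Suc m) \<omega>) \<partial>M) =
    (\<integral>\<^sup>+\<omega>. ennreal (\<Prod>j=k..<k + m. q (waiting j \<omega>)) *
      half_line_conv (\<lambda>w. lam * exp (- lam * w) * q w) f (t - T (k + m) \<omega>) \<partial>M)"
    using nn_integral_weighted_Suc[OF lam, of p f "k + m" t] Suc.prems(2) p0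
    unfolding p[of _ m] p[of _ "Suc m", unfolded add_Suc_right] pk by simp
  also have "\<dots> = (half_line_conv (\<lambda>w. lam * exp (- lam * w)) ^^ k)
      ((half_line_conv (\<lambda>w. lam * exp (- lam * w) * q w) ^^ m) (half_line_conv (\<lambda>w. lam * exp (- lam * w) * q w) f)) t"
    by (rule Suc.IH) (auto simp: half_line_conv_negative)
  finally show ?case by (simp add: funpow_swap1)
qed

text \<open>Given the past, the waiting time after the \<open>n\<close>-th event exceeds
  \<open>t - T n\<close> with the exponential tail probability.\<close>

lemma nn_integral_no_event:
  assumes lam: "0 < lam" and [measurable]: "q \<in> borel_measurable borel" "f \<in> borel_measurable borel"
    and f: "\<And>s. s < 0 \<Longrightarrow> f s = 0"
  shows "(\<integral>\<^sup>+\<omega>. ennreal (\<Prod>j=k..<n. q (waiting j \<omega>)) *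
      (f (t - T n \<omega>) * indicator {t<..} (T (Suc n) \<omega>)) \<partial>M) =
    (\<integral>\<^sup>+\<omega>. ennreal (\<Prod>j=k..<n. q (waiting j \<omega>)) *
      (f (t - T n \<omega>) * ennreal (exp (- lam * (t - T n \<omega>)))) \<partial>M)"
proof -
  define p where "p = (\<lambda>j. if k \<le> j then q else (\<lambda>_. 1))"
  have [measurable]: "p j \<in> borel_measurable borel" for j by (simp add: p_def)
  have p: "(\<Prod>j<n. p j (waiting j \<omega>)) = (\<Prod>j=k..<n. q (waiting j \<omega>))" for \<omega>
    unfolding p_def by (rule prod.mono_neutral_cong_right) auto
  define g where "g = (\<lambda>a w. f (t - a) * (indicator {t<..} (a + w) :: ennreal))"
  have [measurable]: "case_prod g \<in> borel_measurable (borel \<Otimes>\<^sub>M borel)"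
    unfolding g_def by measurable
  have tail: "(\<integral>\<^sup>+w. ennreal (exponential_density lam w) * g a w \<partial>lborel) =
      f (t - a) * ennreal (exp (- lam * (t - a)))" for a
  proof (cases "t - a < 0")
    case True
    then show ?thesis by (simp add: g_def f)
  next
    case False
    have "(\<integral>\<^sup>+w. ennreal (exponential_density lam w) * g a w \<partial>lborel) =
      (\<integral>\<^sup>+w. f (t - a) * (ennreal (exponential_density lam w) * indicator {t - a<..} w) \<partial>lborel)"
      by (intro nn_integral_cong) (auto simp: g_def mult.commute split: split_indicator)
    also have "\<dots> = f (t - a) * ennreal (exp (- lam * (t - a)))"
      using False lam by (subst nn_integral_cmult) (auto simp: nn_integral_exponential_tail simp del: minus_mult_left)
    finally show ?thesis .
  qed
  have "(\<integral>\<^sup>+\<omega>. ennreal (\<Prod>j=k..<n. q (waiting j \<omega>)) *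
      (f (t - T n \<omega>) * indicator {t<..} (T (Suc n) \<omega>)) \<partial>M) =
    (\<integral>\<^sup>+\<omega>. ennreal (\<Prod>j<n. p j (waiting j \<omega>)) * g (T n \<omega>) (waiting n \<omega>) \<partial>M)"
    by (simp add: p g_def)
  also have "\<dots> = (\<integral>\<^sup>+\<omega>. ennreal (\<Prod>j<n. p j (waiting j \<omega>)) *
      (\<integral>\<^sup>+w. ennreal (exponential_density lam w) * g (T n \<omega>) w \<partial>lborel) \<partial>M)"
    by (rule nn_integral_next_waiting) measurable
  finally show ?thesis unfolding tail p .
qed

section \<open>Almost sure behaviour of the event times\<close>

lemma AE_waiting_pos: "AE \<omega> in M. 0 < waiting n \<omega>"
proof -
  have "AE w in lborel. 0 < ennreal (exponential_density lam w) \<longrightarrow> 0 < w"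
    using AE_lborel_singleton[of "0::real"]
    by eventually_elim (auto simp: exponential_density_def split: if_splits)
  moreover have "AE w in distr M lborel (waiting n). 0 < w"
    unfolding distributed_distr_eq_density[OF waiting_time]
    using calculation by (subst AE_density) auto
  then show ?thesis
    by (subst (asm) AE_distr_iff) auto
qed

lemma AE_strict_mono: "AE \<omega> in M. strict_mono (\<lambda>n. T n \<omega>)"
proof -
  have "AE \<omega> in M. \<forall>n. 0 < waiting n \<omega>"
    unfolding AE_all_countable using AE_waiting_pos by blast
  then show ?thesis
    by eventually_elim (simp add: strict_mono_Suc_iff)
qed

text \<open>The probability of \<open>T n \<le> t\<close> is the \<open>n\<close>-fold convolution
  of an indicator, which tends to 0; hence infinitely many events by time \<open>t\<close> are a
  null event.\<close>

lemma AE_event_time_unbounded: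
  assumes lam: "0 < lam" and t: "0 \<le> t"
  shows "AE \<omega> in M. \<exists>n. t < T n \<omega>"
proof -
  define B where "B = {\<omega>\<in>space M. \<forall>n. T n \<omega> \<le> t}"
  have [measurable]: "B \<in> sets M" unfolding B_def by measurable
  have "emeasure M B \<le> (half_line_conv (\<lambda>w. lam * exp (- lam * w)) ^^ n) (indicator {0..}) t" for n
  proof -
    have "emeasure M B = (\<integral>\<^sup>+\<omega>. indicator B \<omega> \<partial>M)" by simp
    also have "\<dots> \<le> (\<integral>\<^sup>+\<omega>. indicator {0..} (t - T n \<omega>) \<partial>M)"
      by (intro nn_integral_mono) (auto simp: B_def split: split_indicator)
    also have "\<dots> = (half_line_conv (\<lambda>w. lam * exp (- lam * w)) ^^ n) (indicator {0..}) t"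
      by (rule nn_integral_event_time[OF lam]) auto
    finally show ?thesis .
  qed
  moreover have "(\<lambda>n. (half_line_conv (\<lambda>w. lam * exp (- lam * w)) ^^ n) (indicator {0..}) t) \<longlonglongrightarrow> 0"
    by (rule half_line_conv_power_tendsto_0[where L = lam and C = 1])
      (use lam t in \<open>auto split: split_indicator\<close>)
  ultimately have "emeasure M B \<le> 0"
    by (intro LIMSEQ_le_const) auto
  then have "B \<in> null_sets M" by auto
  then show ?thesis
    by (rule AE_I'[of B]) (auto simp: B_def not_less)
qed

end

section \<open>The mean value\<close>

text \<open>Where \<open>Im z\<close> is not positive no admissible curve ends at \<open>z\<close>,
  and \<open>hyp_dist\<close> takes the constant default \<open>Inf {}\<close>; elsewhere the
  explicit formula applies.\<close>

lemma cosh_hyp_dist_measurable [measurable]: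
  "(\<lambda>z. cosh (hyp_dist \<i> z)) \<in> borel_measurable borel"
proof -
  have "(\<lambda>z. cosh (hyp_dist \<i> z)) =
      (\<lambda>z. if 0 < Im z then cosh_from_origin z else cosh (Inf {}))"
  proof
    fix z
    show "cosh (hyp_dist \<i> z) = (if 0 < Im z then cosh_from_origin z else cosh (Inf {}))"
    proof (cases "0 < Im z")
      case False
      then have "{hyp_length p | p. p C1_differentiable_on {0..1} \<and>
          (\<forall>s\<in>{0..1}. 0 < Im (p s)) \<and> p 0 = \<i> \<and> p 1 = z} = {}"
        by force
      with False show ?thesis unfolding hyp_dist_def by (simp only: if_False)
    qed (simp add: cosh_hyp_dist)
  qed
  moreover have [measurable]: "Re \<in> borel_measurable borel" "Im \<in> borel_measurable borel"
    by (intro borel_measurable_continuous_onI continuous_intros)+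
  ultimately show ?thesis
    unfolding cosh_from_origin_def by simp
qed

text \<open>The two indicators in the \<open>m\<close>-th term single out N(t) = k + m. At most one
  term is nonzero, and none if fewer than \<open>k\<close> events have occurred.\<close>

lemma cosh_hyp_dist_motion_suminf:
  fixes T :: "nat \<Rightarrow> real"
  assumes mot: "motion c R T e x" and k: "k \<in> R" "R \<subseteq> {1..k}"
    and mono: "strict_mono T" and T0: "T 0 = 0" and t: "0 \<le> t" and unb: "\<exists>n. t < T n"
  shows "ennreal (cosh (hyp_dist \<i> (x t))) * indicator {m. k \<le> m} (card {n. 1 \<le> n \<and> T n \<le> t}) =
    (\<Sum>m. ennreal (\<Prod>j=k..<k + m. cosh (c * (T (Suc j) - T j))) *
      (ennreal (cosh (c * (t - T (k + m)))) * indicator {0..} (t - T (k + m)) *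
        indicator {t<..} (T (Suc (k + m)))))"
    (is "_ = (\<Sum>m. ?f m)")
proof -
  \<comment> \<open>\<open>N\<close> is the index of the first event after \<open>t\<close>, so its
    predecessor \<open>n\<close> is the number of events up to \<open>t\<close>.\<close>
  define N where "N = (LEAST i. t < T i)"
  have N: "t < T N" unfolding N_def using unb by (rule LeastI_ex)
  with T0 t obtain n where Nn: "N = Suc n" by (cases N) auto
  then have n: "T n \<le> t" "t < T (Suc n)"
    using N not_less_Least[of n "\<lambda>i. t < T i"] by (auto simp: N_def[symmetric])
  have card: "card {n. 1 \<le> n \<and> T n \<le> t} = n"
    using count_strict_mono[OF mono n] .
  have zero: "?f m = 0" if "k + m \<noteq> n" for m
  proof (cases "k + m < n")
    case True
    then have "T (Suc (k + m)) \<le> T n" by (simp add: strict_mono_less_eq[OF mono])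
    with n show ?thesis by simp
  next
    case False
    with that have "T (Suc n) \<le> T (k + m)" by (simp add: strict_mono_less_eq[OF mono])
    with n show ?thesis by simp
  qed
  show ?thesis
  proof (cases "k \<le> n")
    case True
    have "(\<Sum>m. ?f m) = (\<Sum>m\<in>{n - k}. ?f m)"
      by (rule suminf_finite) (use zero in auto)
    also have "\<dots> = ennreal (\<Prod>j=k..<n. cosh (c * (T (Suc j) - T j))) * ennreal (cosh (c * (t - T n)))"
      using True n by simp
    also have "\<dots> = ennreal (cosh (hyp_dist \<i> (x t)))"
      by (subst cosh_hyp_dist_motion[OF mot k True n])
        (simp add: ennreal_mult[symmetric] prod_nonneg mult.commute)
    finally show ?thesis unfolding card using True by simp
  next
    case False
    then have "(\<Sum>m. ?f m) = (\<Sum>m. 0)" by (intro suminf_cong zero) auto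
    then show ?thesis unfolding card using False by simp
  qed
qed

text \<open>On the compact interval \<open>{0..s}\<close> the continuous closed form and the kernel
  are bounded, so the renewal series applies. The indicator makes the summands vanish at negative
  times.\<close>

lemma mean_cosh_series:
  assumes lam: "0 < lam" and c: "0 < c" and s: "0 \<le> s"
  shows "(\<Sum>m. (half_line_conv (\<lambda>w. lam * exp (- lam * w) * cosh (c * w)) ^^ m)
      (\<lambda>s. ennreal (exp (- lam * s) * cosh (c * s)) * indicator {0..} s) s) = ennreal (mean_cosh lam c s)"
proof -
  have "\<exists>x\<in>{0..s}. \<forall>u\<in>{0..s}. mean_cosh lam c u \<le> mean_cosh lam c x"
    by (rule continuous_attains_sup) (use s in \<open>auto intro: continuous_on_mean_cosh\<close>)
  then obtain x where x: "\<forall>u\<in>{0..s}. mean_cosh lam c u \<le> mean_cosh lam c x"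
    by blast
  have C: "ennreal (mean_cosh lam c u) \<le> ennreal \<bar>mean_cosh lam c x\<bar>" if "0 \<le> u" "u \<le> s" for u
    by (rule ennreal_leI[OF order_trans[OF _ abs_ge_self]]) (use x that in auto)
  show ?thesis
  proof (rule renewal_series[OF _ _ _ _ _ C])
    fix w :: real assume w: "0 \<le> w" "w \<le> s"
    have "lam * exp (- lam * w) * cosh (c * w) \<le> lam * 1 * cosh (c * s)"
      using lam c w by (intro mult_mono cosh_real_nonneg_le_iff[THEN iffD2]) auto
    then show "lam * exp (- lam * w) * cosh (c * w) \<le> lam * cosh (c * s)" by simp
    show "ennreal (mean_cosh lam c w) = ennreal (exp (- lam * w) * cosh (c * w)) * indicator {0..} w +
        half_line_conv (\<lambda>w. lam * exp (- lam * w) * cosh (c * w)) (\<lambda>s. ennreal (mean_cosh lam c s)) w"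
      using mean_cosh_renewal[OF lam c w(1)] w by simp
  qed (use lam s in auto)
qed

lemma (in poisson_turning) nn_integral_cosh_hyp_dist:
  assumes lam: "0 < lam" and c: "0 < c" and t: "0 \<le> t" and k: "k \<in> R" "R \<subseteq> {1..k}"
    and mot: "AE \<omega> in M. motion c R (\<lambda>n. T n \<omega>) (\<lambda>n. e n \<omega>) (\<lambda>s. X s \<omega>)"
  shows "(\<integral>\<^sup>+\<omega>. ennreal (cosh (hyp_dist \<i> (X t \<omega>))) * indicator {\<omega>\<in>space M. k \<le> event_count T t \<omega>} \<omega> \<partial>M) =
    ennreal (lam ^ k * exp (- lam * t) *
      iterated_integral k (\<lambda>s. exp (lam * (t - s)) * mean_cosh lam c (t - s)) t 0)"
proof -
  let ?K1 = "half_line_conv (\<lambda>w. lam * exp (- lam * w))"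
  let ?Kc = "half_line_conv (\<lambda>w. lam * exp (- lam * w) * cosh (c * w))"
  let ?V = "\<lambda>m \<omega>. ennreal (\<Prod>j=k..<k + m. cosh (c * waiting j \<omega>))"
  let ?f = "\<lambda>s. ennreal (exp (- lam * s) * cosh (c * s)) * indicator {0..} s"
  define \<psi> :: "real \<Rightarrow> ennreal" where "\<psi> = (\<lambda>s. ennreal (cosh (c * s)) * indicator {0..} s)"
  have [measurable]: "\<psi> \<in> borel_measurable borel" unfolding \<psi>_def by measurable
  have "(\<integral>\<^sup>+\<omega>. ennreal (cosh (hyp_dist \<i> (X t \<omega>))) * indicator {\<omega>\<in>space M. k \<le> event_count T t \<omega>} \<omega> \<partial>M) =
    (\<integral>\<^sup>+\<omega>. (\<Sum>m. ?V m \<omega> * (\<psi> (t - T (k + m) \<omega>) * indicator {t<..} (T (Suc (k + m)) \<omega>))) \<partial>M)"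
  proof (rule nn_integral_cong_AE)
    show "AE \<omega> in M. ennreal (cosh (hyp_dist \<i> (X t \<omega>))) * indicator {\<omega>\<in>space M. k \<le> event_count T t \<omega>} \<omega> =
      (\<Sum>m. ?V m \<omega> * (\<psi> (t - T (k + m) \<omega>) * indicator {t<..} (T (Suc (k + m)) \<omega>)))"
      using mot AE_strict_mono AE_event_time_unbounded[OF lam t] AE_space
    proof eventually_elim
      case (elim \<omega>)
      have "indicator {\<omega>\<in>space M. k \<le> event_count T t \<omega>} \<omega> =
          (indicator {m. k \<le> m} (card {n. 1 \<le> n \<and> T n \<omega> \<le> t}) :: ennreal)"
        using elim(4) by (simp add: event_count_def indicator_def)
      then show ?case
        using cosh_hyp_dist_motion_suminf[OF elim(1) k elim(2) T_0[OF elim(4)] t elim(3)]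
        by (simp only: \<psi>_def)
    qed
  qed
  also have "\<dots> = (\<Sum>m. \<integral>\<^sup>+\<omega>. ?V m \<omega> * (\<psi> (t - T (k + m) \<omega>) * indicator {t<..} (T (Suc (k + m)) \<omega>)) \<partial>M)"
    by (rule nn_integral_suminf) measurable
  \<comment> \<open>The absence of a further event up to \<open>t\<close> contributes the
    exponential tail, which turns \<open>\<psi>\<close> into \<open>?f\<close>.\<close>
  also have "\<dots> = (\<Sum>m. \<integral>\<^sup>+\<omega>. ?V m \<omega> * ?f (t - T (k + m) \<omega>) \<partial>M)"
  proof (rule suminf_cong)
    fix m
    have "(\<integral>\<^sup>+\<omega>. ?V m \<omega> * (\<psi> (t - T (k + m) \<omega>) * indicator {t<..} (T (Suc (k + m)) \<omega>)) \<partial>M) =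
      (\<integral>\<^sup>+\<omega>. ?V m \<omega> * (\<psi> (t - T (k + m) \<omega>) * ennreal (exp (- lam * (t - T (k + m) \<omega>)))) \<partial>M)"
      by (rule nn_integral_no_event[OF lam, of "\<lambda>w. cosh (c * w)"]) (auto simp: \<psi>_def)
    also have "\<dots> = (\<integral>\<^sup>+\<omega>. ?V m \<omega> * ?f (t - T (k + m) \<omega>) \<partial>M)"
      by (intro nn_integral_cong)
        (auto simp: \<psi>_def ennreal_mult'[symmetric] mult.commute split: split_indicator)
    finally show "(\<integral>\<^sup>+\<omega>. ?V m \<omega> * (\<psi> (t - T (k + m) \<omega>) * indicator {t<..} (T (Suc (k + m)) \<omega>)) \<partial>M) =
      (\<integral>\<^sup>+\<omega>. ?V m \<omega> * ?f (t - T (k + m) \<omega>) \<partial>M)" .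
  qed
  also have "\<dots> = (\<Sum>m. (?K1 ^^ k) ((?Kc ^^ m) ?f) t)"
    by (intro suminf_cong nn_integral_weighted_event_time[OF lam]) auto
  also have "\<dots> = (?K1 ^^ k) (\<lambda>s. \<Sum>m. (?Kc ^^ m) ?f s) t"
    by (subst half_line_conv_power_suminf) auto
  also have "\<dots> = (?K1 ^^ k) (\<lambda>s. ennreal (mean_cosh lam c s)) t"
    by (rule half_line_conv_power_cong[of t]) (use mean_cosh_series[OF lam c] t in auto)
  also have "\<dots> = ennreal (lam ^ k * exp (- lam * t) *
      iterated_integral k (\<lambda>s. exp (lam * (t - s)) * mean_cosh lam c (t - s)) t 0)"
    using half_line_conv_power_exponential[OF lam t, of "mean_cosh lam c" 0 k]
      mean_cosh_nonneg[OF lam] continuous_on_mean_cosh t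
    by auto
  finally show ?thesis .
qed

text \<open>Dividing the mean over the conditioning event by its probability gives the first
  equality, and Cauchy's formula at 0 the second.\<close>

theorem theorem5p1:
  fixes M :: "'a measure"
    and lam c t :: real
    and k :: nat
    and R :: "nat set"
    and T e :: "nat \<Rightarrow> 'a \<Rightarrow> real"
    and X :: "real \<Rightarrow> 'a \<Rightarrow> complex"
  assumes "0 < lam" and "0 < c" and "0 < t" and "1 \<le> k"
    and "poisson_turning M lam T e"
    and "k \<in> R" and "R \<subseteq> {1..k}"
    and "\<And>s. 0 \<le> s \<Longrightarrow> X s \<in> borel_measurable M"
    and "AE \<omega> in M. motion c R (\<lambda>n. T n \<omega>) (\<lambda>n. e n \<omega>) (\<lambda>s. X s \<omega>)"
  shows "(\<integral>\<omega>. cosh (hyp_dist \<i> (X t \<omega>))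
             \<partial>uniform_measure M {\<omega>\<in>space M. k \<le> event_count T t \<omega>}) =
           lam ^ k * exp (- lam * t) / measure M {\<omega>\<in>space M. k \<le> event_count T t \<omega>} *
             iterated_integral k (\<lambda>s. exp (lam * (t - s)) * mean_cosh lam c (t - s)) t 0 \<and>
         lam ^ k * exp (- lam * t) / measure M {\<omega>\<in>space M. k \<le> event_count T t \<omega>} *
             iterated_integral k (\<lambda>s. exp (lam * (t - s)) * mean_cosh lam c (t - s)) t 0 =
           lam ^ k * exp (- lam * t) /
             (measure M {\<omega>\<in>space M. k \<le> event_count T t \<omega>} * fact (k - 1)) *
             integral {0..t} (\<lambda>s. exp (lam * (t - s)) * s ^ (k - 1) * mean_cosh lam c (t - s))"
proof -
  interpret poisson_turning M lam T e by (rule assms(5))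
  let ?A = "{\<omega>\<in>space M. k \<le> event_count T t \<omega>}"
  let ?g = "\<lambda>s. exp (lam * (t - s)) * mean_cosh lam c (t - s)"
  have X [measurable]: "X t \<in> borel_measurable M" using assms(3,8) by simp
  have A [measurable]: "?A \<in> sets M" by measurable
  have meas: "(\<lambda>\<omega>. cosh (hyp_dist \<i> (X t \<omega>))) \<in> borel_measurable M" by measurable
  have cont: "continuous_on {0..t} ?g"
    by (intro continuous_on_mult continuous_on_exp
      continuous_on_compose2[OF continuous_on_mean_cosh[of UNIV]] continuous_intros) auto
  define r where "r = lam ^ k * exp (- lam * t) * iterated_integral k ?g t 0"
  have "0 \<le> r"
    unfolding r_def using assms(1,3) mean_cosh_nonneg[OF assms(1)]
    by (intro mult_nonneg_nonneg iterated_integral_nonneg[OF cont]) auto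
  have "(\<integral>\<omega>. cosh (hyp_dist \<i> (X t \<omega>)) \<partial>uniform_measure M ?A) =
      enn2real (\<integral>\<^sup>+\<omega>. ennreal (cosh (hyp_dist \<i> (X t \<omega>))) \<partial>uniform_measure M ?A)"
    by (rule integral_eq_nn_integral) (use meas in auto)
  also have "(\<integral>\<^sup>+\<omega>. ennreal (cosh (hyp_dist \<i> (X t \<omega>))) \<partial>uniform_measure M ?A) =
      ennreal r / ennreal (measure M ?A)"
    using meas nn_integral_cosh_hyp_dist[OF assms(1,2) less_imp_le[OF assms(3)] assms(6,7,9)]
    by (subst nn_integral_uniform_measure) (simp_all add: r_def emeasure_eq_measure)
  also have "enn2real (ennreal r / ennreal (measure M ?A)) = r / measure M ?A"
  \<comment> \<open>If the probability is 0, the real quotient is 0 by convention; the extended one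
    is 0 or infinite, and \<open>enn2real\<close> maps both to 0.\<close>
  proof (cases "measure M ?A = 0")
    case True
    then show ?thesis by (cases "r = 0") (auto simp: ennreal_divide_zero)
  next
    case False
    then have "0 < measure M ?A" by (simp add: zero_less_measure_iff)
    then show ?thesis using \<open>0 \<le> r\<close> by (simp add: divide_ennreal)
  qed
  finally have 1: "(\<integral>\<omega>. cosh (hyp_dist \<i> (X t \<omega>)) \<partial>uniform_measure M ?A) =
      lam ^ k * exp (- lam * t) / measure M ?A * iterated_integral k ?g t 0"
    by (simp add: r_def)
  obtain i where k: "k = Suc i" using assms(4) by (cases k) auto
  have "iterated_integral k ?g t 0 = integral {0..t} (\<lambda>s. s ^ (k - 1) / fact (k - 1) * ?g s)"
    using iterated_integral_Suc_eq[OF cont, of i] assms(3) by (simp add: k)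
  also have "\<dots> = integral {0..t} (\<lambda>s. exp (lam * (t - s)) * s ^ (k - 1) * mean_cosh lam c (t - s)) / fact (k - 1)"
    by (subst integral_divide[symmetric]) (auto intro!: integral_cong)
  finally have 2: "iterated_integral k ?g t 0 =
    integral {0..t} (\<lambda>s. exp (lam * (t - s)) * s ^ (k - 1) * mean_cosh lam c (t - s)) / fact (k - 1)" .
  show ?thesis
    unfolding 1 unfolding 2 by simp
qed

end
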